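(* There is a constant $c>0$ depending only on $n$ and $d$ such that for every matrix $A_2$ weight $W:\mathbb{R}^d\to\mathcal{M}_n(\mathbb{C})$, every dyadic grid $\mathscr{D}$ in $\mathbb{R}^d$, and every sparse collection $\mathcal{G}\subset\mathscr{D}$, the sparse operator $$S\vec f=\sum_{I\in\mathcal{G}}(m_I\vec f)\,\chi_I$$ satisfies $$\|S\|_{L^2(W)\to L^2(W)}\le c\,\|W\|_{A_2}^{3/2}.$$
   Context: $n,d\ge1$ are integers; $\mathcal{M}_n(\mathbb{C})$ is the algebra of $n\times n$ complex matrices with operator norm $\|\cdot\|$; $|\cdot|$ is the Euclidean norm on $\mathbb{C}^n$; cubes have sides parallel to the axes; $m_I\vec f$ is the componentwise average of $\vec f$ over $I$. For measurable a.e. positive definite $W$, $L^2(W)$ is the space of measurable $\vec f:\mathbb{R}^d\to\mathbb{C}^n$ with $\|\vec f\|_{L^2(W)}^2=\int_{\mathbb{R}^d}|W^{1/2}\vec f|^2\,dx<\infty$. $W$ is a matrix $A_2$ weight if $$\|W\|_{A_2}:=\sup_{I\text{ cube}}\frac1{|I|}\int_I\frac1{|I|}\int_I\|W^{1/2}(x)W^{-1/2}(t)\|^{2}\,dt\,dx<\infty.$$ A dyadic grid is a nested family of half-open cubes of side lengths $2^k$, $k\in\mathbb{Z}$, such that for each $k$ the cubes of side length $2^k$ partition $\mathbb{R}^d$. A collection $\mathcal{G}\subset\mathscr{D}$ is sparse if for every $I\in\mathcal{G}$, $\sum_{J\in\mathrm{ch}_{\mathcal{G}}(I)}|J|\le\frac12|I|$,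 where $\mathrm{ch}_{\mathcal{G}}(I)$ is the set of $\mathcal{G}$-children of $I$, i.e. the maximal elements of $\mathcal{G}$ strictly contained in $I$. The series defining $S\vec f$ is understood as an unconditional limit in $L^2(W)$ of finite partial sums. *)

theory Defs
  imports "HOL-Analysis.Analysis"
begin

subsection \<open>Complex matrices\<close>

definition hermitian :: "complex^'n^'n \<Rightarrow> bool" where
  "hermitian A \<longleftrightarrow> (\<forall>i j. A $ i $ j = cnj (A $ j $ i))"

definition quad_form :: "complex^'n^'n \<Rightarrow> complex^'n \<Rightarrow> complex" where
  "quad_form A x = (\<Sum>i\<in>UNIV. cnj (x $ i) * (A *v x) $ i)"

definition pos_semidefinite :: "complex^'n^'n \<Rightarrow> bool" where
  "pos_semidefinite A \<longleftrightarrow> hermitian A \<and> (\<forall>x. 0 \<le> Re (quad_form A x))"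

definition pos_definite :: "complex^'n^'n \<Rightarrow> bool" where
  "pos_definite A \<longleftrightarrow> hermitian A \<and> (\<forall>x. x \<noteq> 0 \<longrightarrow> 0 < Re (quad_form A x))"

text \<open>The positive square root; unspecified unless \<open>A\<close> is positive semidefinite.\<close>

definition mat_sqrt :: "complex^'n^'n \<Rightarrow> complex^'n^'n" where
  "mat_sqrt A = (THE B. pos_semidefinite B \<and> B ** B = A)"

definition mat_inv_sqrt :: "complex^'n^'n \<Rightarrow> complex^'n^'n" where
  "mat_inv_sqrt A = matrix_inv (mat_sqrt A)"

definition op_norm :: "complex^'n^'n \<Rightarrow> real" where
  "op_norm A = onorm (\<lambda>x. A *v x)"

subsection \<open>Cubes, dyadic grids, sparse collections\<close>

definition half_open_cube :: "real^'d \<Rightarrow> real \<Rightarrow> (real^'d) set" where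
  "half_open_cube a l = {x. \<forall>i. a $ i \<le> x $ i \<and> x $ i < a $ i + l}"

definition cubes :: "(real^'d) set set" where
  "cubes = {half_open_cube a l | a l. 0 < l}"

definition dyadic_grid :: "(real^'d) set set \<Rightarrow> bool" where
  "dyadic_grid D \<longleftrightarrow>
     (\<forall>Q\<in>D. \<exists>a (k::int). Q = half_open_cube a (2 powi k)) \<and>
     (\<forall>Q\<in>D. \<forall>R\<in>D. Q \<inter> R = {} \<or> Q \<subseteq> R \<or> R \<subseteq> Q) \<and>
     (\<forall>k::int. partition_on UNIV {Q \<in> D. \<exists>a. Q = half_open_cube a (2 powi k)})"

definition children :: "(real^'d) set set \<Rightarrow> (real^'d) set \<Rightarrow> (real^'d) set set" where
  "children G I = {J \<in> G. J \<subset> I \<and> \<not> (\<exists>K\<in>G. J \<subset> K \<and> K \<subset> I)}"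

text \<open>The sum may have infinitely many terms, so it is taken in \<open>ennreal\<close>, where it always exists.\<close>

definition sparse_collection :: "(real^'d) set set \<Rightarrow> bool" where
  "sparse_collection G \<longleftrightarrow> (\<forall>I\<in>G. (\<Sum>\<^sub>\<infinity>J\<in>children G I. emeasure lebesgue J) \<le> emeasure lebesgue I / 2)"

subsection \<open>Matrix weights\<close>

definition matrix_weight :: "(real^'d \<Rightarrow> complex^'n^'n) \<Rightarrow> bool" where
  "matrix_weight W \<longleftrightarrow> W \<in> borel_measurable lebesgue \<and> (AE x in lebesgue. pos_definite (W x))"

text \<open>Cubes are taken half-open here as well; boundaries are null sets.\<close>

definition A2_const :: "(real^'d \<Rightarrow> complex^'n^'n) \<Rightarrow> ennreal" where
  "A2_const W = (SUP I\<in>cubes.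
     (\<integral>\<^sup>+x\<in>I. ((\<integral>\<^sup>+t\<in>I. ennreal ((op_norm (mat_sqrt (W x) ** mat_inv_sqrt (W t)))\<^sup>2) \<partial>lebesgue)
        / emeasure lebesgue I) \<partial>lebesgue) / emeasure lebesgue I)"

definition matrix_A2_weight :: "(real^'d \<Rightarrow> complex^'n^'n) \<Rightarrow> bool" where
  "matrix_A2_weight W \<longleftrightarrow> matrix_weight W \<and> A2_const W < \<infinity>"

subsection \<open>The space \<open>L\<^sup>2(W)\<close> and bounded operators on it\<close>

definition L2_energy :: "(real^'d \<Rightarrow> complex^'n^'n) \<Rightarrow> (real^'d \<Rightarrow> complex^'n) \<Rightarrow> ennreal" where
  "L2_energy W f = (\<integral>\<^sup>+x. ennreal ((norm (mat_sqrt (W x) *v f x))\<^sup>2) \<partial>lebesgue)"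

definition L2_space :: "(real^'d \<Rightarrow> complex^'n^'n) \<Rightarrow> (real^'d \<Rightarrow> complex^'n) set" where
  "L2_space W = {f \<in> borel_measurable lebesgue. L2_energy W f < \<infinity>}"

text \<open>Meaningful only on \<open>L2_space W\<close>, since \<open>enn2real \<infinity> = 0\<close>.\<close>

definition L2_norm :: "(real^'d \<Rightarrow> complex^'n^'n) \<Rightarrow> (real^'d \<Rightarrow> complex^'n) \<Rightarrow> real" where
  "L2_norm W f = sqrt (enn2real (L2_energy W f))"

definition L2_op_norm ::
    "(real^'d \<Rightarrow> complex^'n^'n) \<Rightarrow> ((real^'d \<Rightarrow> complex^'n) \<Rightarrow> (real^'d \<Rightarrow> complex^'n)) \<Rightarrow> ennreal" where
  "L2_op_norm W T = (SUP f\<in>{f \<in> L2_space W. L2_norm W f \<le> 1}. ennreal (L2_norm W (T f)))"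

subsection \<open>Sparse operators\<close>

definition avg :: "(real^'d) set \<Rightarrow> (real^'d \<Rightarrow> complex^'n) \<Rightarrow> complex^'n" where
  "avg I f = (\<chi> i. (LINT x:I|lebesgue. f x $ i) /\<^sub>R measure lebesgue I)"

definition sparse_partial_sum ::
    "(real^'d) set set \<Rightarrow> (real^'d \<Rightarrow> complex^'n) \<Rightarrow> real^'d \<Rightarrow> complex^'n" where
  "sparse_partial_sum F f x = (\<Sum>I\<in>F. indicator I x *\<^sub>R avg I f)"

text \<open>\<open>g\<close> is the unconditional \<open>L\<^sup>2(W)\<close>-limit of the finite partial sums. The integrability clause
  says that the averages exist, excluding the default value 0 of the Bochner integral; convergence
  is stated for the squared norm in \<open>ennreal\<close>, where no default values occur.\<close>

definition has_sparse_sum ::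
    "(real^'d \<Rightarrow> complex^'n^'n) \<Rightarrow> (real^'d) set set \<Rightarrow> (real^'d \<Rightarrow> complex^'n)
      \<Rightarrow> (real^'d \<Rightarrow> complex^'n) \<Rightarrow> bool" where
  "has_sparse_sum W G f g \<longleftrightarrow>
     (\<forall>I\<in>G. \<forall>i. set_integrable lebesgue I (\<lambda>x. f x $ i)) \<and>
     g \<in> L2_space W \<and>
     ((\<lambda>F. L2_energy W (\<lambda>x. g x - sparse_partial_sum F f x)) \<longlongrightarrow> 0) (finite_subsets_at_top G)"

text \<open>The limit is unique up to null sets; any representative is chosen.\<close>

definition sparse_operator ::
    "(real^'d \<Rightarrow> complex^'n^'n) \<Rightarrow> (real^'d) set set \<Rightarrow> (real^'d \<Rightarrow> complex^'n)
      \<Rightarrow> real^'d \<Rightarrow> complex^'n" where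
  "sparse_operator W G f = (SOME g. has_sparse_sum W G f g)"

end

theory Submission
  imports Defs
begin

text \<open>
  Write \<open>A\<close> for the $A_2$ constant of \<open>W\<close> and, for a cube \<open>I\<close>, let \<open>W_I\<close> and \<open>V_I\<close> be the integrals
  over \<open>I\<close> of \<open>W\<close> and of its pointwise inverse, regarded as quadratic forms. Two facts carry the
  proof, and both are statements about quadratic forms only.

  The first is a Carleson embedding (\<open>carleson_embedding\<close>): if the forms of a finite nested family
  satisfy \<open>\<Sum>J\<subseteq>I. W_J \<le> K W_I\<close>, then for arbitrary vectors \<open>v_J\<close> the squared \<open>L2(W)\<close> norm of
  \<open>\<Sum>J. v_J \<chi>_J\<close> is at most \<open>4 K \<Sum>J. \<langle>W_J v_J, v_J\<rangle>\<close>. A sparse family satisfies the hypothesis with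
  \<open>K = 4 A\<close>: for each vector \<open>u\<close> the function \<open>\<langle>W(x) u, u\<rangle>\<close> is a scalar $A_2$ weight with constant at
  most \<open>A\<close>, so its mass on \<open>J\<close> is at most \<open>4 A\<close> times its mass on the part of \<open>J\<close> outside the children
  of \<open>J\<close>, which fills at least half of \<open>J\<close>; and these parts are pairwise disjoint. The inverse weight
  satisfies the same condition.

  The second (\<open>E_le_Es\<close>) is the inequality \<open>W_I \<le> A \<bar>I\<bar>^2 (V_I)^{-1}\<close> between forms, which is what the
  matrix $A_2$ condition says once the operator norm is tested on suitable vectors.

  Let \<open>m_J\<close> be the mean of \<open>f\<close> over \<open>J\<close>, and let \<open>v_J\<close> solve \<open>V_J v_J = \<integral>_J f\<close>. The embedding for \<open>W\<close>
  bounds the squared norm of a finite sparse sum by \<open>16 A \<Sum>J. \<langle>W_J m_J, m_J\<rangle>\<close>; the second fact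
  bounds the last sum by \<open>A X\<close>, where \<open>X = \<Sum>J. \<langle>V_J v_J, v_J\<rangle>\<close>. Finally \<open>X\<close> equals the integral of
  \<open>\<langle>f, \<Sum>J. v_J \<chi>_J\<rangle>\<close>, so by duality it is at most the norm of \<open>f\<close> in \<open>L2(W)\<close> times the norm of
  \<open>\<Sum>J. v_J \<chi>_J\<close> in \<open>L2(W^{-1})\<close>, and the embedding for the inverse weight bounds the latter by the
  square root of \<open>16 A X\<close>. Hence \<open>X \<le> 16 A \<parallel>f\<parallel>^2\<close>, and the squared norm of a finite sparse sum is at
  most \<open>256 A^3 \<parallel>f\<parallel>^2\<close>. The exponent \<open>3/2\<close> collects one factor \<open>A\<close> from each embedding and one from the
  duality between \<open>W\<close> and its inverse.

  For an infinite collection the numbers \<open>\<langle>W_J m_J, m_J\<rangle>\<close> are summable, and the embedding applied to the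
  vectors \<open>m_J\<close> and \<open>- m_J\<close> shows that the finite partial sums form a Cauchy net. A suitable
  sequence of partial sums converges almost everywhere, Fatou's lemma identifies its limit as the limit of the net, and every
  limit inherits the bound up to a factor \<open>2\<close>. All constants are absolute, and \<open>c = 32\<close> works.
\<close>

section \<open>Positive square roots of complex matrices\<close>

lemma matrix_vector_mult_complex_scaleR: "A *v (r *\<^sub>R x) = r *\<^sub>R (A *v x)"
  for A :: "complex^'n^'m"
  by (simp add: linear_scale bounded_linear.linear)

text \<open>Everything below is phrased with the real inner product on \<open>complex^'n\<close>; the complex structure
  enters only through this identity and the two lemmas that relate hermitian to self-adjoint.\<close>

lemma Re_quad_form: "Re (quad_form A x) = x \<bullet> (A *v x)"
  by (simp add: quad_form_def inner_vec_def inner_complex_def algebra_simps)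

lemma hermitian_inner:
  assumes "hermitian A"
  shows "x \<bullet> (A *v y) = (A *v x) \<bullet> y"
proof -
  have "x \<bullet> (A *v y) = (\<Sum>i\<in>UNIV. \<Sum>j\<in>UNIV. Re (cnj (x $ i) * (A $ i $ j * y $ j)))"
    by (simp add: inner_vec_def inner_complex_def matrix_vector_mult_def sum_distrib_left
        algebra_simps sum.distrib sum_subtractf)
  also have "\<dots> = (\<Sum>j\<in>UNIV. \<Sum>i\<in>UNIV. Re (cnj (x $ i) * (A $ i $ j * y $ j)))"
    by (rule sum.swap)
  also have "\<dots> = (\<Sum>j\<in>UNIV. \<Sum>i\<in>UNIV. Re (cnj (A $ j $ i * x $ i) * y $ j))"
  proof -
    have "cnj (A $ j $ i) = A $ i $ j" for i j
      using assms by (metis hermitian_def)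
    then show ?thesis
      by (intro sum.cong refl) (simp add: mult_ac)
  qed
  also have "\<dots> = (A *v x) \<bullet> y"
    by (simp add: inner_vec_def inner_complex_def matrix_vector_mult_def sum_distrib_right
        sum_distrib_left algebra_simps sum.distrib sum_subtractf)
  finally show ?thesis .
qed

lemma matrix_vector_mult_axis: "(A *v axis l d) $ k = A $ k $ l * d"
  for A :: "'a::semiring_1^'n^'m"
  by (simp add: matrix_vector_mult_def axis_def if_distrib[of "(*) _"] cong: if_cong)

text \<open>Testing self-adjointness on \<open>axis j 1\<close> recovers the real parts of the entries and testing it on
  \<open>axis j \<i>\<close> recovers the imaginary parts.\<close>

lemma hermitianI:
  assumes "\<And>x y. x \<bullet> (A *v y) = (A *v x) \<bullet> y"
  shows "hermitian A"
  unfolding hermitian_def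
proof (intro allI complex_eqI)
  fix i j
  have e: "axis k c \<bullet> (A *v axis l d) = Re (cnj c * (A $ k $ l * d))" for k l c d
    by (simp add: inner_axis' inner_complex_def matrix_vector_mult_axis)
  have s: "axis i c \<bullet> (A *v axis j d) = axis j d \<bullet> (A *v axis i c)" for c d
    by (metis assms inner_commute)
  show "Re (A $ i $ j) = Re (cnj (A $ j $ i))"
    using s[of 1 1] by (simp add: e)
  show "Im (A $ i $ j) = Im (cnj (A $ j $ i))"
    using s[of 1 "\<i>"] by (simp add: e)
qed

lemma trace_square_form:
  assumes "hermitian D"
  shows "Re (trace (D ** B ** D)) = (\<Sum>i\<in>UNIV. Re (quad_form B (D *v axis i 1)))"
proof -
  have e: "Re (M $ i $ i) = axis i 1 \<bullet> (M *v axis i 1)" for M :: "complex^'n^'n" and i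
    by (simp add: inner_axis' inner_complex_def matrix_vector_mult_axis)
  have "Re (trace (D ** B ** D)) = (\<Sum>i\<in>UNIV. axis i 1 \<bullet> ((D ** B ** D) *v axis i 1))"
    by (simp add: trace_def e)
  also have "\<dots> = (\<Sum>i\<in>UNIV. Re (quad_form B (D *v axis i 1)))"
    by (simp add: Re_quad_form hermitian_inner[OF assms] flip: matrix_vector_mul_assoc)
  finally show ?thesis .
qed

lemma form_le_onorm:
  fixes A :: "complex^'n^'n"
  shows "x \<bullet> (A *v x) \<le> onorm ((*v) A) * (norm x)\<^sup>2"
proof -
  have "x \<bullet> (A *v x) \<le> norm x * norm (A *v x)" by (rule norm_cauchy_schwarz)
  also have "\<dots> \<le> norm x * (onorm ((*v) A) * norm x)"
    by (intro mult_left_mono onorm) auto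
  finally show ?thesis by (simp add: power2_eq_square mult_ac)
qed

text \<open>Expand the nonnegative number \<open>\<langle>T y, y\<rangle>\<close> at \<open>y = x - (1/q) T x\<close>. The bound has two uses: a zero of
  a positive semidefinite form lies in the kernel, and a form bounded by \<open>q\<close> comes from an operator of
  norm at most \<open>q\<close>.\<close>

lemma norm_square_le_form:
  fixes T :: "'a::real_inner \<Rightarrow> 'a"
  assumes lin: "linear T" and sym: "\<And>x y. x \<bullet> T y = T x \<bullet> y"
    and nn: "\<And>x. 0 \<le> x \<bullet> T x" and le: "\<And>x. x \<bullet> T x \<le> q * (norm x)\<^sup>2" and q: "0 < q"
  shows "(norm (T x))\<^sup>2 \<le> q * (x \<bullet> T x)"
proof -
  define y where "y = T x"
  have "0 \<le> (x - (1 / q) *\<^sub>R y) \<bullet> T (x - (1 / q) *\<^sub>R y)" by (rule nn)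
  also have "\<dots> = x \<bullet> y - (2 / q) * (y \<bullet> y) + (1 / q)\<^sup>2 * (y \<bullet> T y)"
    using sym[of x y] by (simp add: y_def linear_diff[OF lin] linear_scale[OF lin] inner_diff_left inner_diff_right
        power2_eq_square algebra_simps inner_commute)
  also have "(1 / q)\<^sup>2 * (y \<bullet> T y) \<le> (1 / q)\<^sup>2 * (q * (norm y)\<^sup>2)"
    using le by (intro mult_left_mono) auto
  also have "\<dots> = (1 / q) * (y \<bullet> y)"
    using q by (simp add: power2_eq_square dot_square_norm)
  finally have "(1 / q) * (y \<bullet> y) \<le> x \<bullet> y" by simp
  then show ?thesis using q by (simp add: y_def field_simps dot_square_norm)
qed

text \<open>For \<open>D = B - C\<close> the equality of the squares gives \<open>D B + C D = 0\<close>. Multiplying by \<open>D\<close> and taking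
  traces, the traces of \<open>D B D\<close> and \<open>D C D\<close> add up to zero; both are sums of values of positive
  semidefinite forms, so \<open>B\<close> vanishes on every column of \<open>D\<close>, and \<open>B\<close> is definite.\<close>

lemma pos_semidefinite_sqrt_unique:
  fixes B C :: "complex^'n^'n"
  assumes B: "pos_semidefinite B" and C: "pos_semidefinite C" and eq: "B ** B = C ** C"
    and pd: "pos_definite (B ** B)"
  shows "B = C"
proof -
  define D where "D = B - C"
  have herm: "hermitian B" "hermitian C"
    using B C by (auto simp: pos_semidefinite_def)
  then have hD: "hermitian D"
    by (intro hermitianI)
      (simp add: D_def matrix_vector_mult_diff_rdistrib inner_diff_left inner_diff_right hermitian_inner)
  have id: "D ** B + C ** D = 0"
  proof -
    have "D ** B + C ** D = B ** B - C ** C"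
      by (simp add: D_def matrix_matrix_mult_def vec_eq_iff algebra_simps sum_subtractf)
    then show ?thesis by (simp add: eq)
  qed
  have "D ** B ** D + C ** D ** D = 0"
  proof -
    have "D ** B ** D + C ** D ** D = (D ** B + C ** D) ** D"
      by (simp add: matrix_matrix_mult_def[of _ D] vec_eq_iff algebra_simps sum.distrib)
    moreover have "(0 :: complex^'n^'n) ** D = 0"
      by (simp add: matrix_matrix_mult_def vec_eq_iff)
    ultimately show ?thesis by (simp only: id)
  qed
  then have "trace (D ** B ** D) + trace (C ** D ** D) = 0"
    unfolding trace_add[symmetric] by (simp only:) (simp add: trace_def)
  moreover have "trace (C ** D ** D) = trace (D ** C ** D)"
    using trace_mul_sym[of "C ** D" D] by (simp add: matrix_mul_assoc)
  ultimately have "Re (trace (D ** B ** D) + trace (D ** C ** D)) = 0" by simp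
  then have "(\<Sum>i\<in>UNIV. Re (quad_form B (D *v axis i 1)))
      + (\<Sum>i\<in>UNIV. Re (quad_form C (D *v axis i 1))) = 0"
    by (simp add: trace_square_form[OF hD])
  moreover have nn: "0 \<le> Re (quad_form B x)" "0 \<le> Re (quad_form C x)" for x
    using B C by (auto simp: pos_semidefinite_def)
  ultimately have "(\<Sum>i\<in>UNIV. Re (quad_form B (D *v axis i 1))) = 0"
    by (smt (verit, best) sum_nonneg)
  then have z: "Re (quad_form B (D *v axis i 1)) = 0" for i
    using nn by (subst (asm) sum_nonneg_eq_0_iff) auto
  have "x = 0" if "Re (quad_form B x) = 0" for x
  proof (rule ccontr)
    assume "x \<noteq> 0"
    have q: "x \<bullet> (B *v x) = 0" using that by (simp add: Re_quad_form)
    have "linear ((*v) B)" by (rule bounded_linear.linear) simp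
    moreover have "x \<bullet> (B *v x) \<le> (onorm ((*v) B) + 1) * (norm x)\<^sup>2" for x
      using form_le_onorm[of x B] by (simp add: distrib_right add_increasing2)
    moreover have "0 < onorm ((*v) B) + 1" using onorm_pos_le[of "(*v) B"] by simp
    ultimately have "(norm (B *v x))\<^sup>2 \<le> (onorm ((*v) B) + 1) * (x \<bullet> (B *v x))"
      using nn(1) hermitian_inner[OF herm(1)] by (intro norm_square_le_form) (auto simp: Re_quad_form)
    with q have "B *v x = 0" by simp
    then have "Re (quad_form (B ** B) x) = 0"
      by (simp add: Re_quad_form flip: matrix_vector_mul_assoc)
    with pd \<open>x \<noteq> 0\<close> show False by (force simp: pos_definite_def)
  qed
  then have "D *v axis i 1 = 0" for i using z by blast
  then have "D $ k $ i = 0" for k i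
    using matrix_vector_mult_axis[of D i 1 k] by simp
  then have "D = 0" by (simp add: vec_eq_iff)
  then show ?thesis by (simp add: D_def)
qed


lemma pos_definite_coercive:
  fixes A :: "complex^'n^'n"
  assumes "pos_definite A"
  obtains m where "0 < m" "\<And>x. m * (norm x)\<^sup>2 \<le> x \<bullet> (A *v x)"
proof -
  have cont: "continuous_on (sphere 0 1) (\<lambda>x. x \<bullet> (A *v x))"
    by (intro continuous_intros bounded_linear.continuous_on[OF matrix_vector_mul_bounded_linear])
  have "sphere (0::complex^'n) 1 \<noteq> {}" by (simp add: sphere_eq_empty)
  then obtain z where z: "z \<in> sphere 0 1" "\<And>x. x \<in> sphere 0 1 \<Longrightarrow> z \<bullet> (A *v z) \<le> x \<bullet> (A *v x)"
    using continuous_attains_inf[OF compact_sphere _ cont] by blast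
  show ?thesis
  proof (rule that)
    have "z \<noteq> 0" using z(1) by auto
    then show "0 < z \<bullet> (A *v z)" using assms by (auto simp: pos_definite_def Re_quad_form)
    fix x :: "complex^'n"
    show "z \<bullet> (A *v z) * (norm x)\<^sup>2 \<le> x \<bullet> (A *v x)"
    proof (cases "x = 0")
      case False
      define u where "u = (1 / norm x) *\<^sub>R x"
      have "z \<bullet> (A *v z) \<le> u \<bullet> (A *v u)" using False by (intro z(2)) (simp add: u_def)
      also have "\<dots> = (x \<bullet> (A *v x)) / (norm x)\<^sup>2"
        by (simp add: u_def matrix_vector_mult_complex_scaleR power2_eq_square)
      finally show ?thesis using False by (simp add: field_simps)
    qed simp
  qed
qed

text \<open>Scale \<open>A\<close> to \<open>1 - C\<close> with \<open>0 \<le> C \<le> q < 1\<close>. A solution of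
  \<open>Y = (C + Y^2) / 2\<close> satisfies \<open>(1 - Y)^2 = 1 - C\<close>, and the right-hand side is a contraction of the ball
  of radius \<open>r = 1 - sqrt (1 - q)\<close>, the smaller root of \<open>(q + r^2) / 2 = r\<close>. Running the iteration
  inside the closed set of complex linear, self-adjoint operators keeps the fixed point a hermitian
  matrix, and \<open>r < 1\<close> makes \<open>1 - Y\<close> definite.\<close>

lemma pos_definite_sqrt_exists:
  fixes A :: "complex^'n^'n"
  assumes A: "pos_definite A"
  obtains B where "pos_definite B" "B ** B = A"
proof -
  obtain m where m: "0 < m" "\<And>x. m * (norm x)\<^sup>2 \<le> x \<bullet> (A *v x)"
    using pos_definite_coercive[OF A] by blast
  have hA: "hermitian A" using A by (simp add: pos_definite_def)
  define M where "M = onorm ((*v) A) + m"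
  have M: "m \<le> M" using onorm_pos_le[of "(*v) A"] by (simp add: M_def)
  have Aub: "x \<bullet> (A *v x) \<le> M * (norm x)\<^sup>2" for x
    using form_le_onorm[of x A] mult_nonneg_nonneg[OF less_imp_le[OF m(1)] zero_le_power2[of "norm x"]]
    by (simp add: M_def distrib_right)
  \<comment> \<open>above the bound \<open>M\<close> of the form, so that \<open>C\<close> is nonnegative, and above \<open>m\<close>, so that \<open>q\<close> is positive\<close>
  define \<mu> where "\<mu> = M + m"
  define q where "q = 1 - m / \<mu>"
  have \<mu>: "0 < \<mu>" and q: "0 < q" "q < 1" using m M by (auto simp: \<mu>_def q_def)
  define C where "C x = x - (1 / \<mu>) *\<^sub>R (A *v x)" for x
  have linC: "linear C"
    unfolding C_def by (intro linearI) (auto simp: matrix_vector_mult_add_rdistrib matrix_vector_mult_complex_scaleR algebra_simps)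
  have symC: "x \<bullet> C y = C x \<bullet> y" for x y
    by (simp add: C_def inner_diff_left inner_diff_right hermitian_inner[OF hA])
  have Cnn: "0 \<le> x \<bullet> C x" for x
  proof -
    have "x \<bullet> (A *v x) \<le> \<mu> * (norm x)\<^sup>2" using Aub[of x] m by (auto simp: \<mu>_def algebra_simps intro: add_increasing2)
    then show ?thesis using \<mu> by (simp add: C_def inner_diff_right dot_square_norm field_simps)
  qed
  have Cub: "x \<bullet> C x \<le> q * (norm x)\<^sup>2" for x
    using m(2)[of x] \<mu> by (simp add: C_def q_def inner_diff_right dot_square_norm field_simps)
  have Cnorm: "norm (C x) \<le> q * norm x" for x
  proof -
    have "(norm (C x))\<^sup>2 \<le> q * (x \<bullet> C x)" by (rule norm_square_le_form[OF linC symC Cnn Cub q(1)])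
    also have "\<dots> \<le> q * (q * (norm x)\<^sup>2)" using Cub q by (intro mult_left_mono) auto
    finally have "(norm (C x))\<^sup>2 \<le> (q * norm x)\<^sup>2" by (simp add: power2_eq_square mult_ac)
    then show ?thesis by (rule power2_le_imp_le) (use q in simp)
  qed
  define T where "T = Blinfun C"
  have T: "blinfun_apply T x = C x" for x
    using linC by (simp add: T_def bounded_linear_Blinfun_apply linear_linear)
  have normT: "norm T \<le> q"
    using Cnorm q by (intro norm_blinfun_bound) (auto simp: T)
  define r where "r = 1 - sqrt (1 - q)"
  have r: "0 < r" "r < 1" using q by (auto simp: r_def)
  have rr: "(q + r * r) / 2 = r"
    using q by (simp add: r_def field_simps)
  define f where "f Y = (1/2) *\<^sub>R (T + (Y o\<^sub>L Y))" for Y :: "(complex^'n) \<Rightarrow>\<^sub>L (complex^'n)"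
  have f: "blinfun_apply (f Y) x = (1/2) *\<^sub>R (C x + blinfun_apply Y (blinfun_apply Y x))" for Y x
    by (simp add: f_def T blinfun.bilinear_simps)
  define S where "S = {Y :: (complex^'n) \<Rightarrow>\<^sub>L (complex^'n).
      (\<forall>x. blinfun_apply Y (\<i> *s x) = \<i> *s blinfun_apply Y x) \<and>
      (\<forall>x y. x \<bullet> blinfun_apply Y y = blinfun_apply Y x \<bullet> y) \<and> norm Y \<le> r}"
  have icont: "continuous_on UNIV (\<lambda>Y. \<i> *s (blinfun_apply Y x))" for x :: "complex^'n"
    unfolding vector_scalar_mult_def by (intro continuous_intros)
  have "closed S"
    unfolding S_def by (intro closed_Collect_conj closed_Collect_all closed_Collect_eq closed_Collect_le
        continuous_intros icont)
  then have comp: "complete S" by (simp add: complete_eq_closed)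
  have "0 \<in> S" using r by (simp add: S_def)
  then have ne: "S \<noteq> {}" by blast
  have im: "f ` S \<subseteq> S"
  proof safe
    fix Y assume Y: "Y \<in> S"
    then have nY: "norm Y \<le> r" by (simp add: S_def)
    have "norm (f Y) \<le> (q + r * r) / 2"
    proof -
      have "norm (Y o\<^sub>L Y) \<le> r * r"
        using norm_blinfun_compose[of Y Y] nY r by (meson mult_mono norm_ge_zero order_trans less_imp_le)
      then have "norm (T + (Y o\<^sub>L Y)) \<le> q + r * r" using normT norm_triangle_ineq[of T "Y o\<^sub>L Y"] by linarith
      then show ?thesis by (simp add: f_def)
    qed
    moreover have "C (\<i> *s x) = \<i> *s C x" for x
      by (simp add: C_def vector_scalar_mult_def matrix_vector_mult_def vec_eq_iff sum_distrib_left algebra_simps)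
    then have "blinfun_apply (f Y) (\<i> *s x) = \<i> *s blinfun_apply (f Y) x" for x
      using Y by (simp add: S_def f) (simp add: vec_eq_iff algebra_simps)
    moreover have "x \<bullet> blinfun_apply (f Y) y = blinfun_apply (f Y) x \<bullet> y" for x y
      using Y by (simp add: S_def f inner_add_left inner_add_right symC)
    ultimately show "f Y \<in> S" using rr by (simp add: S_def)
  qed
  have contr: "dist (f Y) (f Z) \<le> r * dist Y Z" if "Y \<in> S" "Z \<in> S" for Y Z
  proof -
    have n: "norm Y \<le> r" "norm Z \<le> r" using that by (auto simp: S_def)
    have "(Y o\<^sub>L Y) - (Z o\<^sub>L Z) = (Y o\<^sub>L (Y - Z)) + ((Y - Z) o\<^sub>L Z)"
      by (intro blinfun_eqI) (simp add: blinfun.bilinear_simps)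
    then have "norm ((Y o\<^sub>L Y) - (Z o\<^sub>L Z)) \<le> norm (Y o\<^sub>L (Y - Z)) + norm ((Y - Z) o\<^sub>L Z)"
      by (metis norm_triangle_ineq)
    also have "\<dots> \<le> norm Y * norm (Y - Z) + norm (Y - Z) * norm Z"
      by (intro add_mono norm_blinfun_compose)
    also have "\<dots> \<le> r * norm (Y - Z) + norm (Y - Z) * r"
      by (intro add_mono mult_left_mono mult_right_mono n) auto
    finally have "norm ((Y o\<^sub>L Y) - (Z o\<^sub>L Z)) \<le> 2 * r * norm (Y - Z)" by simp
    moreover have "f Y - f Z = (1/2) *\<^sub>R ((Y o\<^sub>L Y) - (Z o\<^sub>L Z))" by (simp add: f_def algebra_simps)
    ultimately show ?thesis by (simp add: dist_norm)
  qed
  obtain Y where Y: "Y \<in> S" "f Y = Y"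
    using Banach_fix[OF comp ne _ r(2) im] contr r by (metis less_imp_le)
  define g where "g x = sqrt \<mu> *\<^sub>R (x - blinfun_apply Y x)" for x
  have Yi: "blinfun_apply Y (\<i> *s x) = \<i> *s blinfun_apply Y x" for x using Y by (simp add: S_def)
  have cs: "c *s x = Re c *\<^sub>R x + Im c *\<^sub>R (\<i> *s x)" for c and x :: "complex^'n"
    by (simp add: vec_eq_iff complex_eq_iff)
  have Yc: "blinfun_apply Y (c *s x) = c *s blinfun_apply Y x" for c x
    by (subst (1 2) cs) (simp add: blinfun.bilinear_simps Yi)
  have "Vector_Spaces.linear (*s) (*s) g"
    by unfold_locales (simp_all add: g_def Yc blinfun.bilinear_simps vec_eq_iff algebra_simps)
  then have B: "matrix g *v x = g x" for x by (rule matrix_works)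
  have sym: "x \<bullet> g y = g x \<bullet> y" for x y
    using Y by (simp add: g_def S_def inner_diff_left inner_diff_right)
  have "hermitian (matrix g)" using sym by (intro hermitianI) (simp add: B)
  moreover have "0 < x \<bullet> g x" if "x \<noteq> 0" for x
  proof -
    have "norm (blinfun_apply Y x) \<le> norm Y * norm x" by (rule norm_blinfun)
    also have "\<dots> \<le> r * norm x" using Y by (intro mult_right_mono) (auto simp: S_def)
    also have "\<dots> < norm x" using that r by simp
    finally have "norm x * norm (blinfun_apply Y x) < norm x * norm x" using that by simp
    then have "x \<bullet> blinfun_apply Y x < x \<bullet> x"
      using norm_cauchy_schwarz[of x "blinfun_apply Y x"] by (simp add: dot_square_norm power2_eq_square)
    then show ?thesis using \<mu> by (simp add: g_def inner_diff_right)
  qed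
  ultimately have "pos_definite (matrix g)" by (simp add: pos_definite_def Re_quad_form B)
  moreover have "matrix g ** matrix g = A"
  proof -
    have fix2: "2 *\<^sub>R blinfun_apply Y x = C x + blinfun_apply Y (blinfun_apply Y x)" for x
      by (subst Y(2)[symmetric]) (simp only: f, simp)
    have "(matrix g ** matrix g) *v x = A *v x" for x
    proof -
      have "(matrix g ** matrix g) *v x = g (g x)" by (simp add: B flip: matrix_vector_mul_assoc)
      also have "\<dots> = \<mu> *\<^sub>R (x - 2 *\<^sub>R blinfun_apply Y x + blinfun_apply Y (blinfun_apply Y x))"
        using \<mu> by (simp add: g_def blinfun.bilinear_simps algebra_simps scaleR_2)
      also have "\<dots> = \<mu> *\<^sub>R (x - C x)" by (simp add: fix2)
      also have "\<dots> = A *v x" using \<mu> by (simp add: C_def)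
      finally show ?thesis .
    qed
    then show ?thesis by (simp add: matrix_eq)
  qed
  ultimately show ?thesis by (rule that)
qed

lemma mat_sqrt_pos_definite:
  fixes A :: "complex^'n^'n"
  assumes A: "pos_definite A"
  shows "pos_definite (mat_sqrt A)" and "mat_sqrt A ** mat_sqrt A = A"
proof -
  have psd: "pos_semidefinite B" if "pos_definite B" for B :: "complex^'n^'n"
    unfolding pos_semidefinite_def
  proof (intro conjI allI)
    fix x show "0 \<le> Re (quad_form B x)"
      using that by (cases "x = 0") (auto simp: pos_definite_def Re_quad_form less_imp_le)
  qed (use that in \<open>simp add: pos_definite_def\<close>)
  obtain B where B: "pos_definite B" "B ** B = A" using pos_definite_sqrt_exists[OF A] by blast
  have "mat_sqrt A = B"
    unfolding mat_sqrt_def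
    using B A by (intro the_equality) (auto intro: psd pos_semidefinite_sqrt_unique)
  with B show "pos_definite (mat_sqrt A)" and "mat_sqrt A ** mat_sqrt A = A" by auto
qed

section \<open>A Carleson embedding for quadratic forms\<close>

lemma norm_square_add_le:
  fixes a b :: "'a::real_normed_vector"
  assumes "0 < e"
  shows "(norm (a + b))\<^sup>2 \<le> (1 + e) * (norm a)\<^sup>2 + (1 + 1 / e) * (norm b)\<^sup>2"
proof -
  have "(norm (a + b))\<^sup>2 \<le> (norm a + norm b)\<^sup>2"
    by (intro power_mono norm_triangle_ineq) auto
  also have "\<dots> = (norm a)\<^sup>2 + 2 * (norm a * norm b) + (norm b)\<^sup>2"
    by (simp add: power2_eq_square algebra_simps)
  also have "2 * (norm a * norm b) \<le> e * (norm a)\<^sup>2 + (1 / e) * (norm b)\<^sup>2"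
  proof -
    have "0 \<le> (e * norm a - norm b)\<^sup>2 / e" using assms by simp
    also have "\<dots> = e * (norm a)\<^sup>2 - 2 * (norm a * norm b) + (1 / e) * (norm b)\<^sup>2"
      using assms by (simp add: power2_eq_square field_simps)
    finally show ?thesis by simp
  qed
  finally show ?thesis by (simp add: algebra_simps)
qed

text \<open>For \<open>T x\<close> the square root of \<open>W x\<close> and \<open>S = UNIV\<close> this is the squared norm of \<open>h\<close> in \<open>L2(W)\<close>; for a
  constant function \<open>h\<close> it is the quadratic form of the integral of \<open>W\<close> over \<open>S\<close>.\<close>

definition energy_on ::
    "'x measure \<Rightarrow> ('x \<Rightarrow> 'v \<Rightarrow> 'v::euclidean_space) \<Rightarrow> 'x set \<Rightarrow> ('x \<Rightarrow> 'v) \<Rightarrow> ennreal" where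
  "energy_on M T S h = (\<integral>\<^sup>+x\<in>S. ennreal ((norm (T x (h x)))\<^sup>2) \<partial>M)"

lemma energy_on_cong: "(\<And>x. x \<in> S \<Longrightarrow> h x = k x) \<Longrightarrow> energy_on M T S h = energy_on M T S k"
  unfolding energy_on_def by (intro nn_integral_cong) (auto split: split_indicator)

lemma energy_on_mono: "S \<subseteq> S' \<Longrightarrow> energy_on M T S h \<le> energy_on M T S' h"
  unfolding energy_on_def by (intro nn_integral_mono) (auto split: split_indicator)

text \<open>Measurability is imposed on the quadratic form along measurable vector fields: for a weight this is
  \<open>\<langle>W(x) h(x), h(x)\<rangle>\<close>, a polynomial in the entries of \<open>W\<close> and \<open>h\<close>, whereas the measurability of \<open>T\<close>
  would involve the dependence of the square root on the matrix.\<close>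

locale measurable_form =
  fixes M :: "'x measure" and T :: "'x \<Rightarrow> 'v \<Rightarrow> 'v::euclidean_space"
  assumes lin: "\<And>x. linear (T x)"
    and meas: "\<And>h. h \<in> borel_measurable M \<Longrightarrow> (\<lambda>x. (norm (T x (h x)))\<^sup>2) \<in> borel_measurable M"
begin

abbreviation en where "en \<equiv> energy_on M T"

lemma en_split:
  assumes "h \<in> borel_measurable M" "S \<in> sets M" "I \<in> sets M" "I \<subseteq> S"
  shows "en S h = en I h + en (S - I) h"
proof -
  have "en S h = (\<integral>\<^sup>+x\<in>I \<union> (S - I). ennreal ((norm (T x (h x)))\<^sup>2) \<partial>M)"
    using assms(4) by (simp add: energy_on_def Un_absorb1)
  also have "\<dots> = en I h + en (S - I) h"
    unfolding energy_on_def using assms meas by (intro nn_integral_disjoint_pair) auto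
  finally show ?thesis .
qed

lemma en_add_le:
  assumes [measurable]: "h \<in> borel_measurable M" "k \<in> borel_measurable M" "S \<in> sets M" and e: "0 < e"
  shows "en S (\<lambda>x. h x + k x) \<le> ennreal (1 + e) * en S h + ennreal (1 + 1 / e) * en S k"
proof -
  note [measurable] = meas
  have "en S (\<lambda>x. h x + k x) \<le> (\<integral>\<^sup>+x. ennreal (1 + e) * (ennreal ((norm (T x (h x)))\<^sup>2) * indicator S x)
      + ennreal (1 + 1 / e) * (ennreal ((norm (T x (k x)))\<^sup>2) * indicator S x) \<partial>M)"
    unfolding energy_on_def
  proof (intro nn_integral_mono)
    fix x
    have "ennreal ((norm (T x (h x + k x)))\<^sup>2)
        \<le> ennreal ((1 + e) * (norm (T x (h x)))\<^sup>2 + (1 + 1 / e) * (norm (T x (k x)))\<^sup>2)"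
      using norm_square_add_le[OF e, of "T x (h x)" "T x (k x)"]
      by (intro ennreal_leI) (simp add: linear_add[OF lin])
    also have "\<dots> = ennreal (1 + e) * ennreal ((norm (T x (h x)))\<^sup>2)
        + ennreal (1 + 1 / e) * ennreal ((norm (T x (k x)))\<^sup>2)"
      using e by (simp flip: ennreal_mult ennreal_plus)
    finally show "ennreal ((norm (T x (h x + k x)))\<^sup>2) * indicator S x
       \<le> ennreal (1 + e) * (ennreal ((norm (T x (h x)))\<^sup>2) * indicator S x)
      + ennreal (1 + 1 / e) * (ennreal ((norm (T x (k x)))\<^sup>2) * indicator S x)"
      by (auto split: split_indicator)
  qed
  also have "\<dots> = ennreal (1 + e) * en S h + ennreal (1 + 1 / e) * en S k"
    unfolding energy_on_def using assms meas by (simp add: nn_integral_add nn_integral_cmult)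
  finally show ?thesis .
qed

text \<open>The induction removes a maximal member \<open>I\<close>: the remaining members lie inside \<open>I\<close> or are disjoint
  from it, and the two groups are treated separately on \<open>I\<close> and on \<open>S - I\<close>. On \<open>I\<close> the constant vector
  changes from \<open>P\<close> to \<open>P + v I\<close>, and this is why an arbitrary vector \<open>P\<close> is carried along. The middle
  term is the reserve that pays for the change: with \<open>N\<close> the form of \<open>I\<close> plus \<open>1/K\<close> times the forms of
  all members contained in \<open>I\<close>, including \<open>I\<close>, the Carleson condition gives \<open>N \<le> 2 W_I\<close>, so dropping the contribution of \<open>I\<close>
  to the reserve shrinks \<open>N\<close> at least by the factor \<open>1 - 1/(2K)\<close>, which compensates the factor \<open>1 + e\<close> in
  \<open>norm_square_add_le\<close> for \<open>e = 1/(2K - 1)\<close>.\<close>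

theorem carleson_embedding_shifted:
  fixes v :: "'x set \<Rightarrow> 'v" and K :: real
  assumes K: "1 \<le> K"
    and F: "finite F" "F \<subseteq> sets M"
    and nested: "\<And>I J. I \<in> F \<Longrightarrow> J \<in> F \<Longrightarrow> I \<inter> J = {} \<or> I \<subseteq> J \<or> J \<subseteq> I"
    and ne: "{} \<notin> F"
    and fin: "\<And>I u. I \<in> F \<Longrightarrow> en I (\<lambda>_. u) < \<infinity>"
    and carleson: "\<And>I u. I \<in> F \<Longrightarrow> (\<Sum>J\<in>{J\<in>F. J \<subseteq> I}. en J (\<lambda>_. u)) \<le> ennreal K * en I (\<lambda>_. u)"
    and S: "S \<in> sets M" "\<And>I. I \<in> F \<Longrightarrow> I \<subseteq> S"
  shows "en S (\<lambda>x. P + (\<Sum>J\<in>F. indicator J x *\<^sub>R v J))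
      \<le> en S (\<lambda>_. P) + ennreal (1 / K) * (\<Sum>J\<in>F. en J (\<lambda>_. P)) + ennreal (4 * K) * (\<Sum>J\<in>F. en J (\<lambda>_. v J))"
  using F nested ne fin carleson S
proof (induction "card F" arbitrary: F S P rule: less_induct)
  case less
  show ?case
  proof (cases "F = {}")
    case True
    then show ?thesis by simp
  next
    case False
    then obtain I where I: "I \<in> F" and max: "\<And>J. J \<in> F \<Longrightarrow> I \<subseteq> J \<Longrightarrow> J = I"
      using finite_has_maximal[OF less.prems(1)] by metis
    define A where "A = {J \<in> F. J \<subset> I}"
    define B where "B = {J \<in> F. J \<inter> I = {}}"
    have trichotomy: "J = I \<or> J \<subset> I \<or> J \<inter> I = {}" if "J \<in> F" for J
      using less.prems(3)[OF that I] max[OF that] by blast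
    have I0: "I \<noteq> {}" using I less.prems(4) by blast
    have AB1: "F = insert I (A \<union> B)"
      using trichotomy I unfolding A_def B_def by blast
    have AB2: "I \<notin> A \<union> B" using I0 by (simp add: A_def B_def)
    have "J \<noteq> {}" if "J \<in> F" for J using that less.prems(4) by blast
    then have AB3: "A \<inter> B = {}" unfolding A_def B_def by blast
    note AB = AB1 AB2 AB3
    have finAB: "finite A" "finite B" using less.prems(1) by (auto simp: A_def B_def)
    have sumF: "(\<Sum>J\<in>F. g J) = g I + (\<Sum>J\<in>A. g J) + (\<Sum>J\<in>B. g J)" for g :: "'x set \<Rightarrow> 'z::comm_monoid_add"
      using AB finAB by (simp add: sum.union_disjoint add.assoc)
    have cAB: "card A < card F" "card B < card F"
      by (rule psubset_card_mono[OF less.prems(1)], use AB1 AB2 in blast)+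
    have subA: "A \<subseteq> F" and subB: "B \<subseteq> F" by (auto simp: A_def B_def)
    have IM: "I \<in> sets M" "I \<subseteq> S" using I less.prems by auto
    have Fm: "J \<in> sets M" if "J \<in> F" for J using that less.prems(2) by auto
    define Q where "Q = P + v I"
    have carl: "(\<Sum>J\<in>{J\<in>C. J \<subseteq> L}. en J (\<lambda>_. u)) \<le> ennreal K * en L (\<lambda>_. u)" if "C \<subseteq> F" "L \<in> C" for C L u
    proof -
      have "(\<Sum>J\<in>{J\<in>C. J \<subseteq> L}. en J (\<lambda>_. u)) \<le> (\<Sum>J\<in>{J\<in>F. J \<subseteq> L}. en J (\<lambda>_. u))"
        using that less.prems(1) by (intro sum_mono2) auto
      also have "\<dots> \<le> ennreal K * en L (\<lambda>_. u)" using that by (intro less.prems(6)) auto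
      finally show ?thesis .
    qed
    have IHA: "en I (\<lambda>x. Q + (\<Sum>J\<in>A. indicator J x *\<^sub>R v J))
      \<le> en I (\<lambda>_. Q) + ennreal (1 / K) * (\<Sum>J\<in>A. en J (\<lambda>_. Q)) + ennreal (4 * K) * (\<Sum>J\<in>A. en J (\<lambda>_. v J))"
    proof (rule less.hyps[OF cAB(1) finAB(1)])
      show "A \<subseteq> sets M" "{} \<notin> A" using subA less.prems(2,4) by auto
      show "L \<inter> J = {} \<or> L \<subseteq> J \<or> J \<subseteq> L" if "L \<in> A" "J \<in> A" for L J
        using less.prems(3) that subA by blast
      show "en L (\<lambda>_. u) < \<infinity>" if "L \<in> A" for L u
        using less.prems(5) that subA by blast
      show "(\<Sum>J\<in>{J \<in> A. J \<subseteq> L}. en J (\<lambda>_. u)) \<le> ennreal K * en L (\<lambda>_. u)" if "L \<in> A" for L u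
        using carl[OF subA that] .
      show "I \<in> sets M" using IM less.prems(7) by auto
      show "L \<subseteq> I" if "L \<in> A" for L
        using that less.prems(8)[of L] by (auto simp: A_def)
    qed
    have IHB: "en (S - I) (\<lambda>x. P + (\<Sum>J\<in>B. indicator J x *\<^sub>R v J))
      \<le> en (S - I) (\<lambda>_. P) + ennreal (1 / K) * (\<Sum>J\<in>B. en J (\<lambda>_. P)) + ennreal (4 * K) * (\<Sum>J\<in>B. en J (\<lambda>_. v J))"
    proof (rule less.hyps[OF cAB(2) finAB(2)])
      show "B \<subseteq> sets M" "{} \<notin> B" using subB less.prems(2,4) by auto
      show "L \<inter> J = {} \<or> L \<subseteq> J \<or> J \<subseteq> L" if "L \<in> B" "J \<in> B" for L J
        using less.prems(3) that subB by blast
      show "en L (\<lambda>_. u) < \<infinity>" if "L \<in> B" for L u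
        using less.prems(5) that subB by blast
      show "(\<Sum>J\<in>{J \<in> B. J \<subseteq> L}. en J (\<lambda>_. u)) \<le> ennreal K * en L (\<lambda>_. u)" if "L \<in> B" for L u
        using carl[OF subB that] .
      show "S - I \<in> sets M" using IM less.prems(7) by auto
      show "L \<subseteq> S - I" if "L \<in> B" for L
        using that less.prems(8)[of L] by (auto simp: B_def)
    qed
    have main: "en I (\<lambda>_. Q) + ennreal (1 / K) * (\<Sum>J\<in>A. en J (\<lambda>_. Q))
        \<le> en I (\<lambda>_. P) + ennreal (1 / K) * (en I (\<lambda>_. P) + (\<Sum>J\<in>A. en J (\<lambda>_. P))) + ennreal (4 * K) * en I (\<lambda>_. v I)"
    proof -
      define a where "a u = enn2real (en I (\<lambda>_. u))" for u
      define b where "b u = (\<Sum>J\<in>A. enn2real (en J (\<lambda>_. u)))" for u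
      have a: "en I (\<lambda>_. u) = ennreal (a u)" "0 \<le> a u" for u
        using less.prems(5)[OF I, of u] by (auto simp: a_def less_top)
      have b: "(\<Sum>J\<in>A. en J (\<lambda>_. u)) = ennreal (b u)" "0 \<le> b u" for u
      proof -
        have "en J (\<lambda>_. u) = ennreal (enn2real (en J (\<lambda>_. u)))" if "J \<in> A" for J
          using less.prems(5)[of J u] that subA by (auto simp: less_top)
        then show "(\<Sum>J\<in>A. en J (\<lambda>_. u)) = ennreal (b u)"
          by (simp add: b_def flip: sum_ennreal)
      qed (simp add: b_def sum_nonneg)
      have ab: "b u + a u \<le> K * a u" for u
      proof -
        have "{J \<in> F. J \<subseteq> I} = insert I A" using I by (auto simp: A_def)
        then have "ennreal (a u) + ennreal (b u) \<le> ennreal K * ennreal (a u)"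
          using less.prems(6)[OF I, of u] finAB AB(2) by (simp add: a b)
        then show ?thesis using a b K by (simp flip: ennreal_plus ennreal_mult add: ennreal_le_iff)
      qed
      \<comment> \<open>chosen so that \<open>(1 - 1/(2K)) (1 + e) = 1\<close>\<close>
      define e where "e = 1 / (2 * K - 1)"
      have e: "0 < e" using K by (simp add: e_def)
      have e1: "1 + 1 / e = 2 * K" by (simp add: e_def)
      have e2: "(1 - 1 / (2 * K)) * (1 + e) = 1" using K by (simp add: e_def field_simps)
      have add: "en J (\<lambda>_. Q) \<le> ennreal (1 + e) * en J (\<lambda>_. P) + ennreal (2 * K) * en J (\<lambda>_. v I)"
        if "J \<in> sets M" for J
        using en_add_le[of "\<lambda>_. P" "\<lambda>_. v I" J e] that e e1 by (simp add: Q_def)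
      have aQ: "a Q \<le> (1 + e) * a P + (2 * K) * a (v I)"
        using add[OF IM(1)] a e K by (simp flip: ennreal_plus ennreal_mult add: ennreal_le_iff)
      have bQ: "b Q \<le> (1 + e) * b P + (2 * K) * b (v I)"
      proof -
        have "(\<Sum>J\<in>A. en J (\<lambda>_. Q)) \<le> (\<Sum>J\<in>A. ennreal (1 + e) * en J (\<lambda>_. P) + ennreal (2 * K) * en J (\<lambda>_. v I))"
          by (intro sum_mono add) (auto simp: A_def Fm)
        also have "\<dots> = ennreal (1 + e) * (\<Sum>J\<in>A. en J (\<lambda>_. P)) + ennreal (2 * K) * (\<Sum>J\<in>A. en J (\<lambda>_. v I))"
          by (simp add: sum.distrib sum_distrib_left)
        finally show ?thesis
          using b e K by (simp flip: ennreal_plus ennreal_mult add: ennreal_le_iff)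
      qed
      define N where "N u = a u + (a u + b u) / K" for u
      have N2: "N u \<le> 2 * a u" "0 \<le> N u" for u
        using ab[of u] K a(2)[of u] b(2)[of u] by (auto simp: N_def field_simps)
      have NQ: "N Q \<le> (1 + e) * N P + (2 * K) * N (v I)"
      proof -
        have "(a Q + b Q) / K \<le> ((1 + e) * a P + (2 * K) * a (v I) + ((1 + e) * b P + (2 * K) * b (v I))) / K"
          using aQ bQ K by (intro divide_right_mono) auto
        then have "N Q \<le> (1 + e) * a P + (2 * K) * a (v I)
          + ((1 + e) * a P + (2 * K) * a (v I) + ((1 + e) * b P + (2 * K) * b (v I))) / K"
          using aQ by (simp add: N_def)
        also have "\<dots> = (1 + e) * N P + (2 * K) * N (v I)"
          using K by (simp add: N_def field_simps)
        finally show ?thesis .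
      qed
      have "a Q + b Q / K = N Q - a Q / K" using K by (simp add: N_def field_simps)
      \<comment> \<open>\<open>N Q \<le> 2 a Q\<close>: the dropped term is at least the fraction \<open>1/(2K)\<close> of \<open>N Q\<close>\<close>
      also have "\<dots> \<le> (1 - 1 / (2 * K)) * N Q"
        using N2(1)[of Q] K by (simp add: field_simps)
      also have "\<dots> \<le> (1 - 1 / (2 * K)) * ((1 + e) * N P + (2 * K) * N (v I))"
        using NQ K by (intro mult_left_mono) (auto simp: field_simps)
      also have "\<dots> = N P + (2 * K - 1) * N (v I)"
      proof -
        have "(1 - 1 / (2 * K)) * ((1 + e) * N P + (2 * K) * N (v I))
          = ((1 - 1 / (2 * K)) * (1 + e)) * N P + ((1 - 1 / (2 * K)) * (2 * K)) * N (v I)" by algebra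
        also have "(1 - 1 / (2 * K)) * (2 * K) = 2 * K - 1" using K by (simp add: field_simps)
        finally show ?thesis by (simp add: e2)
      qed
      also have "(2 * K - 1) * N (v I) \<le> 2 * K * (2 * a (v I))"
        using N2[of "v I"] K a(2) by (intro mult_mono) auto
      finally have "a Q + b Q / K \<le> a P + (a P + b P) / K + 4 * K * a (v I)"
        by (simp add: N_def)
      then show ?thesis
        unfolding a(1) b(1) using a(2) b(2) K
        by (simp flip: ennreal_plus ennreal_mult add: ennreal_le_iff)
    qed
    have hm: "(\<lambda>x. P + (\<Sum>J\<in>F. indicator J x *\<^sub>R v J)) \<in> borel_measurable M"
      using Fm by (intro borel_measurable_add borel_measurable_sum borel_measurable_scaleR
          borel_measurable_indicator borel_measurable_const) auto
    have eqI: "en I (\<lambda>x. P + (\<Sum>J\<in>F. indicator J x *\<^sub>R v J)) = en I (\<lambda>x. Q + (\<Sum>J\<in>A. indicator J x *\<^sub>R v J))"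
    proof (intro energy_on_cong)
      fix x assume x: "x \<in> I"
      then have "(\<Sum>J\<in>B. indicator J x *\<^sub>R v J) = 0" by (intro sum.neutral) (auto simp: B_def indicator_def)
      then show "P + (\<Sum>J\<in>F. indicator J x *\<^sub>R v J) = Q + (\<Sum>J\<in>A. indicator J x *\<^sub>R v J)"
        using x by (simp add: sumF Q_def add.assoc)
    qed
    have eqB: "en (S - I) (\<lambda>x. P + (\<Sum>J\<in>F. indicator J x *\<^sub>R v J)) = en (S - I) (\<lambda>x. P + (\<Sum>J\<in>B. indicator J x *\<^sub>R v J))"
    proof (intro energy_on_cong)
      fix x assume x: "x \<in> S - I"
      then have "(\<Sum>J\<in>A. indicator J x *\<^sub>R v J) = 0" by (intro sum.neutral) (auto simp: A_def indicator_def)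
      then show "P + (\<Sum>J\<in>F. indicator J x *\<^sub>R v J) = P + (\<Sum>J\<in>B. indicator J x *\<^sub>R v J)"
        using x by (simp add: sumF)
    qed
    have "en S (\<lambda>x. P + (\<Sum>J\<in>F. indicator J x *\<^sub>R v J))
       = en I (\<lambda>x. Q + (\<Sum>J\<in>A. indicator J x *\<^sub>R v J)) + en (S - I) (\<lambda>x. P + (\<Sum>J\<in>B. indicator J x *\<^sub>R v J))"
      using en_split[OF hm less.prems(7) IM] by (simp add: eqI eqB)
    also have "\<dots> \<le> (en I (\<lambda>_. Q) + ennreal (1 / K) * (\<Sum>J\<in>A. en J (\<lambda>_. Q)) + ennreal (4 * K) * (\<Sum>J\<in>A. en J (\<lambda>_. v J)))
       + (en (S - I) (\<lambda>_. P) + ennreal (1 / K) * (\<Sum>J\<in>B. en J (\<lambda>_. P)) + ennreal (4 * K) * (\<Sum>J\<in>B. en J (\<lambda>_. v J)))"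
      by (intro add_mono IHA IHB)
    also have "\<dots> \<le> (en I (\<lambda>_. P) + ennreal (1 / K) * (en I (\<lambda>_. P) + (\<Sum>J\<in>A. en J (\<lambda>_. P))) + ennreal (4 * K) * en I (\<lambda>_. v I)
        + ennreal (4 * K) * (\<Sum>J\<in>A. en J (\<lambda>_. v J)))
       + (en (S - I) (\<lambda>_. P) + ennreal (1 / K) * (\<Sum>J\<in>B. en J (\<lambda>_. P)) + ennreal (4 * K) * (\<Sum>J\<in>B. en J (\<lambda>_. v J)))"
      by (intro add_mono main order_refl)
    also have "\<dots> = (en I (\<lambda>_. P) + en (S - I) (\<lambda>_. P)) + ennreal (1 / K) * (\<Sum>J\<in>F. en J (\<lambda>_. P))
       + ennreal (4 * K) * (\<Sum>J\<in>F. en J (\<lambda>_. v J))"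
      by (simp add: sumF distrib_left ac_simps)
    also have "en I (\<lambda>_. P) + en (S - I) (\<lambda>_. P) = en S (\<lambda>_. P)"
      using en_split[of "\<lambda>_. P" S I] less.prems(7) IM by simp
    finally show ?thesis .
  qed
qed

corollary carleson_embedding:
  fixes v :: "'x set \<Rightarrow> 'v" and K :: real
  assumes K: "1 \<le> K"
    and F: "finite F" "F \<subseteq> sets M"
    and nested: "\<And>I J. I \<in> F \<Longrightarrow> J \<in> F \<Longrightarrow> I \<inter> J = {} \<or> I \<subseteq> J \<or> J \<subseteq> I"
    and ne: "{} \<notin> F"
    and fin: "\<And>I u. I \<in> F \<Longrightarrow> en I (\<lambda>_. u) < \<infinity>"
    and carleson: "\<And>I u. I \<in> F \<Longrightarrow> (\<Sum>J\<in>{J\<in>F. J \<subseteq> I}. en J (\<lambda>_. u)) \<le> ennreal K * en I (\<lambda>_. u)"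
  shows "energy_on M T UNIV (\<lambda>x. \<Sum>J\<in>F. indicator J x *\<^sub>R v J)
      \<le> ennreal (4 * K) * (\<Sum>J\<in>F. en J (\<lambda>_. v J))"
proof -
  have z: "en S (\<lambda>_. 0) = 0" for S by (simp add: energy_on_def linear_0[OF lin])
  have "en UNIV h = en (space M) h" for h
    unfolding energy_on_def by (intro nn_integral_cong) auto
  moreover have "en (space M) (\<lambda>x. 0 + (\<Sum>J\<in>F. indicator J x *\<^sub>R v J))
      \<le> en (space M) (\<lambda>_. 0) + ennreal (1 / K) * (\<Sum>J\<in>F. en J (\<lambda>_. 0)) + ennreal (4 * K) * (\<Sum>J\<in>F. en J (\<lambda>_. v J))"
    using F(2) by (intro carleson_embedding_shifted K F nested ne fin carleson) (auto dest: sets.sets_into_space)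
  ultimately show ?thesis by (simp add: z)
qed

end

section \<open>Scalar weights, cubes and sparse collections\<close>

text \<open>For every measurable subset \<open>E\<close> of \<open>I\<close> the Cauchy-Schwarz inequality bounds the square of the measure
  of \<open>E\<close> by the mass \<open>w(E)\<close> times the integral of \<open>1/w\<close> over \<open>I\<close>. Combined with the $A_2$ inequality,
  \<open>E = I\<close> gives \<open>1 \<le> A\<close>, and a set \<open>E\<close> filling half of \<open>I\<close> carries at least the fraction \<open>1/(4 A)\<close> of the
  mass. The mass is finite because the product is finite and the integral of \<open>1/w\<close> is positive.\<close>

lemma scalar_A2:
  fixes w :: "'x \<Rightarrow> real"
  assumes w [measurable]: "w \<in> borel_measurable M" and pos: "\<And>x. 0 < w x"
    and I [measurable]: "I \<in> sets M" and I0: "emeasure M I \<noteq> 0" and Ifin: "emeasure M I \<noteq> \<infinity>"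
    and A2: "(\<integral>\<^sup>+x\<in>I. ennreal (w x) \<partial>M) * (\<integral>\<^sup>+x\<in>I. ennreal (1 / w x) \<partial>M) \<le> ennreal A * (emeasure M I)\<^sup>2"
  shows "(\<integral>\<^sup>+x\<in>I. ennreal (w x) \<partial>M) < \<infinity>" and "1 \<le> A"
    and "\<lbrakk>E \<in> sets M; E \<subseteq> I; emeasure M I \<le> 2 * emeasure M E\<rbrakk> \<Longrightarrow>
      (\<integral>\<^sup>+x\<in>I. ennreal (w x) \<partial>M) \<le> ennreal (4 * A) * (\<integral>\<^sup>+x\<in>E. ennreal (w x) \<partial>M)"
proof -
  let ?w = "\<integral>\<^sup>+x\<in>I. ennreal (w x) \<partial>M" and ?s = "\<integral>\<^sup>+x\<in>I. ennreal (1 / w x) \<partial>M"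
  have "?s \<noteq> 0"
  proof
    assume "?s = 0"
    then have "AE x in M. ennreal (1 / w x) * indicator I x = 0"
      by (subst (asm) nn_integral_0_iff_AE) auto
    then have "AE x in M. x \<notin> I"
      using pos by (auto simp: indicator_def split: if_splits elim!: eventually_mono) (metis divide_pos_pos ennreal_eq_0_iff not_less zero_less_one)
    with I0 I show False by (auto simp flip: AE_iff_null_sets[OF I])
  qed
  moreover have "?w * ?s < \<infinity>"
    using Ifin by (intro le_less_trans[OF A2]) (simp add: ennreal_mult_less_top power_less_top_ennreal less_top)
  ultimately show "?w < \<infinity>" by (auto simp: ennreal_mult_less_top)
  have cs: "(emeasure M E)\<^sup>2 \<le> (\<integral>\<^sup>+x\<in>E. ennreal (w x) \<partial>M) * ?s"
    if E [measurable]: "E \<in> sets M" and EI: "E \<subseteq> I" for E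
  proof -
    have "(emeasure M E)\<^sup>2 = (\<integral>\<^sup>+x. (ennreal (sqrt (w x)) * indicator E x) * (ennreal (sqrt (1 / w x)) * indicator E x) \<partial>M)\<^sup>2"
    proof -
      have "(ennreal (sqrt (w x)) * indicator E x) * (ennreal (sqrt (1 / w x)) * indicator E x) = indicator E x" for x
        using pos[of x] by (auto simp: real_sqrt_divide simp flip: ennreal_mult split: split_indicator)
      then show ?thesis by simp
    qed
    also have "\<dots> \<le> (\<integral>\<^sup>+x. (ennreal (sqrt (w x)) * indicator E x)\<^sup>2 \<partial>M) * (\<integral>\<^sup>+x. (ennreal (sqrt (1 / w x)) * indicator E x)\<^sup>2 \<partial>M)"
      by (intro Cauchy_Schwarz_nn_integral) auto
    also have "\<dots> \<le> (\<integral>\<^sup>+x\<in>E. ennreal (w x) \<partial>M) * ?s"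
    proof (intro mult_mono nn_integral_mono)
      fix x
      show "(ennreal (sqrt (w x)) * indicator E x)\<^sup>2 \<le> ennreal (w x) * indicator E x"
        using pos[of x] by (auto simp: ennreal_power split: split_indicator)
      show "(ennreal (sqrt (1 / w x)) * indicator E x)\<^sup>2 \<le> ennreal (1 / w x) * indicator I x"
        using pos[of x] EI by (auto simp: ennreal_power real_sqrt_divide power_divide split: split_indicator)
    qed auto
    finally show ?thesis .
  qed
  show "1 \<le> A"
  proof -
    have "1 * (emeasure M I)\<^sup>2 \<le> ennreal A * (emeasure M I)\<^sup>2"
      using order_trans[OF cs[OF I order_refl] A2] by simp
    then have "1 \<le> ennreal A"
      using I0 Ifin by (subst (asm) (1 2) mult.commute, subst (asm) ennreal_mult_le_mult_iff)
        (auto simp: power_eq_top_ennreal)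
    then show ?thesis by simp
  qed
  assume E: "E \<in> sets M" and EI: "E \<subseteq> I" and half: "emeasure M I \<le> 2 * emeasure M E"
  let ?e = "\<integral>\<^sup>+x\<in>E. ennreal (w x) \<partial>M"
  have E2: "(emeasure M E)\<^sup>2 \<le> ?e * ?s" by (rule cs[OF E EI])
  have "(emeasure M I)\<^sup>2 * ?w \<le> (2 * emeasure M E)\<^sup>2 * ?w"
    using half by (intro mult_right_mono power_mono) auto
  also have "\<dots> \<le> 4 * (?e * ?s) * ?w"
    using E2 by (intro mult_right_mono) (auto simp: power_mult_distrib intro!: mult_left_mono)
  also have "\<dots> = 4 * ?e * (?w * ?s)" by (simp add: mult_ac)
  also have "\<dots> \<le> 4 * ?e * (ennreal A * (emeasure M I)\<^sup>2)" by (intro mult_left_mono A2) auto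
  also have "\<dots> = (emeasure M I)\<^sup>2 * (ennreal (4 * A) * ?e)"
  proof -
    have "ennreal (4 * A) = 4 * ennreal A" by (simp add: ennreal_mult')
    then show ?thesis by (simp add: mult_ac)
  qed
  finally show "?w \<le> ennreal (4 * A) * ?e"
    using I0 Ifin by (subst (asm) ennreal_mult_le_mult_iff) (auto simp: power_eq_top_ennreal)
qed

lemma half_open_cube_sets [measurable]: "half_open_cube a l \<in> sets borel"
proof -
  have "half_open_cube a l = (\<Inter>i\<in>UNIV. {x. a $ i \<le> x $ i} \<inter> {x. x $ i < a $ i + l})"
    by (auto simp: half_open_cube_def)
  also have "\<dots> \<in> sets borel"
    by (intro sets.finite_INT sets.Int borel_closed borel_open closed_Collect_le open_Collect_less
        continuous_intros) auto
  finally show ?thesis .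
qed

lemma box_subset_half_open_cube: "box a (a + (\<chi> i. l)) \<subseteq> half_open_cube a l"
  by (auto simp: half_open_cube_def mem_box_cart less_imp_le)

lemma half_open_cube_subset_cbox: "half_open_cube a l \<subseteq> cbox a (a + (\<chi> i. l))"
  by (auto simp: half_open_cube_def mem_box_cart less_imp_le)

lemma
  assumes "I \<in> cubes"
  shows cubes_lebesgue: "I \<in> sets lebesgue"
    and emeasure_cubes_nonzero: "emeasure lebesgue I \<noteq> 0"
    and emeasure_cubes_finite: "emeasure lebesgue I \<noteq> \<infinity>"
    and cubes_interior: "interior I \<noteq> {}"
proof -
  obtain a l where I: "I = half_open_cube a l" "0 < l" using assms by (auto simp: cubes_def)
  show s: "I \<in> sets lebesgue" by (simp add: I)
  have "box a (a + (\<chi> i. l)) \<noteq> {}" using I(2) by (simp add: interval_ne_empty_cart)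
  moreover have "box a (a + (\<chi> i. l)) \<subseteq> interior I"
    unfolding I(1) by (rule interior_maximal[OF box_subset_half_open_cube open_box])
  ultimately show int: "interior I \<noteq> {}" by blast
  have "emeasure lebesgue (interior I) \<noteq> 0"
    using int open_not_negligible[of "interior I"] by (auto simp: negligible_iff_emeasure0)
  then show "emeasure lebesgue I \<noteq> 0"
    using emeasure_mono[OF interior_subset s] by auto
  have "emeasure lebesgue I \<le> emeasure lebesgue (cbox a (a + (\<chi> i. l)))"
    using half_open_cube_subset_cbox by (intro emeasure_mono) (auto simp: I)
  also have "\<dots> < \<infinity>" using emeasure_bounded_finite[OF bounded_cbox] by simp
  finally show "emeasure lebesgue I \<noteq> \<infinity>" by simp
qed

lemma half_open_cube_subsetD:
  assumes sub: "half_open_cube a l \<subseteq> half_open_cube b m" and l: "0 < l"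
  shows "b $ i \<le> a $ i" and "a $ i + l \<le> b $ i + m"
proof -
  have "a \<in> half_open_cube a l" using l by (simp add: half_open_cube_def)
  with sub show "b $ i \<le> a $ i" by (auto simp: half_open_cube_def)
  show "a $ i + l \<le> b $ i + m"
  proof (rule ccontr)
    assume less: "\<not> a $ i + l \<le> b $ i + m"
    define t where "t = max 0 (b $ i + m - a $ i)"
    have "(\<chi> j. if j = i then a $ i + t else a $ j) \<in> half_open_cube a l"
      using less l by (auto simp: half_open_cube_def t_def)
    with sub have "(\<chi> j. if j = i then a $ i + t else a $ j) \<in> half_open_cube b m" by blast
    then have "a $ i + t < b $ i + m" by (auto simp: half_open_cube_def dest: spec[of _ i])
    then show False by (simp add: t_def max_def split: if_splits)
  qed
qed

lemma half_open_cube_subset_side: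
  fixes a b :: "real^'d"
  assumes sub: "half_open_cube a l \<subseteq> half_open_cube b m" and l: "0 < l"
  shows "l \<le> m" and "l = m \<Longrightarrow> a = b"
proof -
  show "l \<le> m"
    using half_open_cube_subsetD[OF assms, of undefined] by linarith
  assume "l = m"
  then have "a $ i = b $ i" for i
    using half_open_cube_subsetD[OF assms, of i] by linarith
  then show "a = b" by (simp add: vec_eq_iff)
qed

lemma dyadic_gridD_cubes:
  assumes "dyadic_grid D"
  shows "D \<subseteq> cubes"
proof
  fix Q assume "Q \<in> D"
  then obtain a and k :: int where "Q = half_open_cube a (2 powi k)"
    using assms unfolding dyadic_grid_def by meson
  moreover have "(0::real) < 2 powi k" by simp
  ultimately show "Q \<in> cubes" unfolding cubes_def by blast
qed

text \<open>Sides are powers of two and bounded by the side of \<open>I\<close>, so among the members between \<open>J\<close> and \<open>I\<close> one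
  has largest side; since a cube contained in another cube with the same side equals it, this one is
  maximal.\<close>

lemma children_cover:
  assumes D: "dyadic_grid D" and G: "G \<subseteq> D" and J: "J \<in> G" "J \<subset> I" and I: "I \<in> G"
  obtains K where "K \<in> children G I" "J \<subseteq> K"
proof -
  have cube: "\<exists>a (k::int). Q = half_open_cube a (2 powi k)" if "Q \<in> G" for Q
  proof -
    have "\<forall>Q\<in>D. \<exists>a (k::int). Q = half_open_cube a (2 powi k)"
      using D by (simp add: dyadic_grid_def)
    then show ?thesis using G that by blast
  qed
  obtain b m where Ib: "I = half_open_cube b (2 powi m)" using cube[OF I] by blast
  define P where "P k \<longleftrightarrow> (\<exists>K\<in>G. J \<subseteq> K \<and> K \<subset> I \<and> (\<exists>a. K = half_open_cube a (2 powi k)))" for k :: int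
  have mono: "k \<le> l" if "half_open_cube a (2 powi k) \<subseteq> half_open_cube a' (2 powi l)" for a a' :: "real^'d" and k l :: int
  proof (rule ccontr)
    assume "\<not> k \<le> l"
    then have "(2::real) powi l < 2 powi k" by (intro power_int_strict_increasing) auto
    with half_open_cube_subset_side(1)[OF that] show False by simp
  qed
  have bd: "k \<le> m" if "P k" for k
    using that mono unfolding P_def Ib by blast
  obtain k0 where k0: "P k0" using cube[OF J(1)] J unfolding P_def by blast
  \<comment> \<open>\<open>m - n\<close> is the largest exponent of a member between \<open>J\<close> and \<open>I\<close>\<close>
  define n where "n = (LEAST n. P (m - int n))"
  have ex: "P (m - int (nat (m - k0)))" using k0 bd[OF k0] by simp
  have Pn: "P (m - int n)" unfolding n_def by (rule LeastI[of "\<lambda>n. P (m - int n)", OF ex])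
  have least: "k \<le> m - int n" if "P k" for k
  proof -
    have "P (m - int (nat (m - k)))" using that bd[OF that] by simp
    then have "n \<le> nat (m - k)" unfolding n_def by (rule Least_le)
    then show ?thesis using bd[OF that] by linarith
  qed
  obtain K a where K: "K \<in> G" "J \<subseteq> K" "K \<subset> I" "K = half_open_cube a (2 powi (m - int n))"
    using Pn unfolding P_def by blast
  have "\<not> (\<exists>L\<in>G. K \<subset> L \<and> L \<subset> I)"
  proof
    assume "\<exists>L\<in>G. K \<subset> L \<and> L \<subset> I"
    then obtain L where L: "L \<in> G" "K \<subset> L" "L \<subset> I" by blast
    obtain c l where Lc: "L = half_open_cube c (2 powi l)" using cube[OF L(1)] by blast
    have "P l" unfolding P_def using L K(2) Lc by blast
    then have "l \<le> m - int n" by (rule least)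
    moreover have "m - int n \<le> l" using mono L(2) K(4) Lc by blast
    ultimately have l: "l = m - int n" by simp
    have "K \<subseteq> L" using L(2) by blast
    then have "half_open_cube a (2 powi l) \<subseteq> half_open_cube c (2 powi l)"
      by (simp only: K(4) Lc l)
    then have "a = c" by (rule half_open_cube_subset_side(2)) simp_all
    then have "K = L" by (simp only: K(4) Lc l)
    with L(2) show False by blast
  qed
  then show ?thesis using K by (intro that[of K]) (auto simp: children_def)
qed

lemma emeasure_Union_le_infsum:
  assumes "countable C" "C \<subseteq> sets M"
  shows "emeasure M (\<Union>C) \<le> (\<Sum>\<^sub>\<infinity>J\<in>C. emeasure M J)"
proof (cases "C = {}")
  case False
  define f where "f = from_nat_into C"
  have f: "range f = C" unfolding f_def using False assms(1) by (rule range_from_nat_into)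
  have m: "f n \<in> sets M" for n using assms(2) f by blast
  have "(\<Union>n. \<Union>i\<le>n. f i) = \<Union>C" using f by auto
  have "emeasure M (\<Union>C) = (SUP n. emeasure M (\<Union>i\<le>n. f i))"
  proof -
    have "incseq (\<lambda>n. \<Union>i\<le>n. f i)" by (intro monoI UN_mono) auto
    moreover have "range (\<lambda>n. \<Union>i\<le>n. f i) \<subseteq> sets M" using m by (auto intro!: sets.finite_UN)
    ultimately have "(SUP n. emeasure M (\<Union>i\<le>n. f i)) = emeasure M (\<Union>n. \<Union>i\<le>n. f i)"
      by (intro SUP_emeasure_incseq)
    with \<open>(\<Union>n. \<Union>i\<le>n. f i) = \<Union>C\<close> show ?thesis by simp
  qed
  also have "\<dots> \<le> (\<Sum>\<^sub>\<infinity>J\<in>C. emeasure M J)"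
  proof (rule SUP_least)
    fix n
    have "(\<Union>i\<le>n. f i) = (\<Union>J\<in>f ` {..n}. J)" by auto
    then have "emeasure M (\<Union>i\<le>n. f i) \<le> (\<Sum>J\<in>f ` {..n}. emeasure M J)"
      using m emeasure_subadditive_finite[of "f ` {..n}" "\<lambda>J. J" M] by auto
    also have "\<dots> \<le> (\<Sum>\<^sub>\<infinity>J\<in>C. emeasure M J)"
      using f by (subst nonneg_infsum_complete) (auto intro!: SUP_upper)
    finally show "emeasure M (\<Union>i\<le>n. f i) \<le> (\<Sum>\<^sub>\<infinity>J\<in>C. emeasure M J)" .
  qed
  finally show ?thesis .
qed simp

text \<open>The points of \<open>J\<close> that lie in no smaller member of \<open>G\<close>, usually called \<open>E_J\<close>.\<close>

definition core :: "(real^'d) set set \<Rightarrow> (real^'d) set \<Rightarrow> (real^'d) set" where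
  "core G J = J - \<Union>(children G J)"

locale sparse_family =
  fixes D G :: "(real^'d) set set"
  assumes grid: "dyadic_grid D" and in_grid: "G \<subseteq> D" and sparse: "sparse_collection G"
begin

lemma member_cubes: "J \<in> G \<Longrightarrow> J \<in> cubes"
  using dyadic_gridD_cubes[OF grid] in_grid by blast

lemma members_nested: "J \<in> G \<Longrightarrow> L \<in> G \<Longrightarrow> J \<inter> L = {} \<or> J \<subseteq> L \<or> L \<subseteq> J"
proof -
  assume "J \<in> G" "L \<in> G"
  moreover have "\<forall>Q\<in>D. \<forall>R\<in>D. Q \<inter> R = {} \<or> Q \<subseteq> R \<or> R \<subseteq> Q"
    using grid by (simp add: dyadic_grid_def)
  ultimately show ?thesis using in_grid by blast
qed

lemma countable_children: "countable (children G I)"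
proof (rule countable_disjoint_nonempty_interior_subsets)
  show "pairwise disjnt (children G I)"
  proof (rule pairwiseI)
    fix J L assume "J \<in> children G I" "L \<in> children G I" "J \<noteq> L"
    then show "disjnt J L"
      using members_nested[of J L] unfolding children_def disjnt_def by blast
  qed
  show "J = {}" if "J \<in> children G I" "interior J = {}" for J
  proof -
    have "J \<in> G" using that(1) by (simp add: children_def)
    with that(2) show ?thesis using cubes_interior[OF member_cubes, of J] by simp
  qed
qed

lemma children_sets: "children G J \<subseteq> sets lebesgue"
proof
  fix L assume "L \<in> children G J"
  then have "L \<in> G" by (simp add: children_def)
  then show "L \<in> sets lebesgue" by (rule cubes_lebesgue[OF member_cubes])
qed

lemma Union_children_sets: "\<Union>(children G J) \<in> sets lebesgue"
  by (rule sets.countable_Union[OF countable_children children_sets])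

lemma core_sets: "J \<in> G \<Longrightarrow> core G J \<in> sets lebesgue"
  unfolding core_def by (intro sets.Diff Union_children_sets cubes_lebesgue member_cubes)

lemma emeasure_core:
  assumes J: "J \<in> G"
  shows "emeasure lebesgue J \<le> 2 * emeasure lebesgue (core G J)"
proof -
  let ?U = "\<Union>(children G J)"
  have Js: "J \<in> sets lebesgue" and Us: "?U \<in> sets lebesgue"
    by (rule cubes_lebesgue[OF member_cubes[OF J]], rule Union_children_sets)
  have sub: "?U \<subseteq> J" by (auto simp: children_def)
  have "emeasure lebesgue ?U \<le> (\<Sum>\<^sub>\<infinity>L\<in>children G J. emeasure lebesgue L)"
    by (rule emeasure_Union_le_infsum[OF countable_children children_sets])
  also have "\<dots> \<le> emeasure lebesgue J / 2"
    using sparse J unfolding sparse_collection_def by blast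
  finally have U: "emeasure lebesgue ?U \<le> emeasure lebesgue J / 2" .
  have "emeasure lebesgue J = emeasure lebesgue (core G J) + emeasure lebesgue ?U"
    using plus_emeasure[of "core G J" lebesgue ?U] core_sets[OF J] Us sub
    by (simp add: core_def Un_absorb2 Int_commute Diff_disjoint)
  moreover obtain j where "emeasure lebesgue J = ennreal j" "0 \<le> j"
    using emeasure_cubes_finite[OF member_cubes[OF J]] by (cases "emeasure lebesgue J") auto
  moreover obtain u where "emeasure lebesgue ?U = ennreal u" "0 \<le> u"
    using U calculation by (cases "emeasure lebesgue ?U") (auto simp: top_unique divide_ennreal)
  moreover obtain e where "emeasure lebesgue (core G J) = ennreal e" "0 \<le> e"
    using calculation by (cases "emeasure lebesgue (core G J)") auto
  ultimately show ?thesis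
    using U by (simp add: divide_ennreal flip: ennreal_plus ennreal_mult' ennreal_numeral)
qed

lemma core_disjoint:
  assumes "J \<in> G" "L \<in> G" "J \<noteq> L"
  shows "core G J \<inter> core G L = {}"
proof -
  have *: "core G J \<inter> L = {}" if "J \<in> G" "L \<in> G" "L \<subset> J" for J L
  proof -
    note JL = that
    obtain K where "K \<in> children G J" "L \<subseteq> K"
      by (rule children_cover[OF grid in_grid JL(2,3,1)])
    then show ?thesis unfolding core_def by blast
  qed
  have sub: "core G J \<subseteq> J" for J by (auto simp: core_def)
  consider "J \<inter> L = {}" | "J \<subset> L" | "L \<subset> J"
    using assms members_nested[of J L] by blast
  then show ?thesis
  proof cases
    case 1
    then show ?thesis using sub[of J] sub[of L] by blast
  next
    case 2
    then show ?thesis using *[of L J] assms sub[of J] by blast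
  next
    case 3
    then show ?thesis using *[of J L] assms sub[of L] by blast
  qed
qed

text \<open>The disjoint cores turn a bound of each mass by the mass of its core into the Carleson condition.\<close>

lemma carleson_of_core:
  assumes F: "finite F" "F \<subseteq> G" and w: "w \<in> borel_measurable lebesgue"
    and K: "\<And>J. J \<in> F \<Longrightarrow> (\<integral>\<^sup>+x\<in>J. w x \<partial>lebesgue) \<le> ennreal K * (\<integral>\<^sup>+x\<in>core G J. w x \<partial>lebesgue)"
  shows "(\<Sum>J\<in>{J\<in>F. J \<subseteq> I}. (\<integral>\<^sup>+x\<in>J. w x \<partial>lebesgue)) \<le> ennreal K * (\<integral>\<^sup>+x\<in>I. w x \<partial>lebesgue)"
proof -
  let ?F = "{J\<in>F. J \<subseteq> I}"
  have ind: "(\<Sum>J\<in>?F. indicator (core G J) x) \<le> (indicator I x :: ennreal)" for x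
  proof (cases "\<exists>J\<in>?F. x \<in> core G J")
    case True
    then obtain J where J: "J \<in> ?F" "x \<in> core G J" by blast
    have "(\<Sum>L\<in>?F. indicator (core G L) x) = (\<Sum>L\<in>{J}. indicator (core G L) x :: ennreal)"
    proof (rule sum.mono_neutral_right)
      show "\<forall>L\<in>?F - {J}. indicator (core G L) x = (0::ennreal)"
        using core_disjoint[of J] J F(2) by (auto simp: indicator_def)
    qed (use F J in auto)
    then show ?thesis using J by (auto simp: core_def)
  qed (simp add: sum.neutral)
  have "(\<Sum>J\<in>?F. (\<integral>\<^sup>+x\<in>J. w x \<partial>lebesgue)) \<le> (\<Sum>J\<in>?F. ennreal K * (\<integral>\<^sup>+x\<in>core G J. w x \<partial>lebesgue))"
    using K by (intro sum_mono) auto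
  also have "\<dots> = ennreal K * (\<integral>\<^sup>+x. (\<Sum>J\<in>?F. w x * indicator (core G J) x) \<partial>lebesgue)"
    using w F core_sets by (subst nn_integral_sum) (auto simp: sum_distrib_left intro!: borel_measurable_times borel_measurable_indicator)
  also have "\<dots> \<le> ennreal K * (\<integral>\<^sup>+x\<in>I. w x \<partial>lebesgue)"
    using ind by (intro mult_left_mono nn_integral_mono) (auto simp flip: sum_distrib_left intro!: mult_left_mono)
  finally show ?thesis .
qed

end

section \<open>A weight and its inverse on a single cube\<close>

text \<open>The $A_2$ kernel is only ever bounded below by products of functions of one variable. Those are
  measurable, and their iterated integral factors.\<close>

lemma product_le_iterated_integral:
  assumes [measurable]: "f \<in> borel_measurable M" "g \<in> borel_measurable M" "I \<in> sets M"
    and le: "\<And>x t. f x * g t \<le> k x t"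
  shows "(\<integral>\<^sup>+x\<in>I. f x \<partial>M) * (\<integral>\<^sup>+t\<in>I. g t \<partial>M) \<le> (\<integral>\<^sup>+x\<in>I. (\<integral>\<^sup>+t\<in>I. k x t \<partial>M) \<partial>M)"
proof -
  have "(\<integral>\<^sup>+x\<in>I. f x \<partial>M) * (\<integral>\<^sup>+t\<in>I. g t \<partial>M) = (\<integral>\<^sup>+x. (f x * indicator I x) * (\<integral>\<^sup>+t\<in>I. g t \<partial>M) \<partial>M)"
    by (rule nn_integral_multc[symmetric]) simp
  also have "\<dots> = (\<integral>\<^sup>+x\<in>I. (\<integral>\<^sup>+t\<in>I. f x * g t \<partial>M) \<partial>M)"
  proof (rule nn_integral_cong)
    fix x
    have "(\<integral>\<^sup>+t\<in>I. f x * g t \<partial>M) = f x * (\<integral>\<^sup>+t\<in>I. g t \<partial>M)"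
      by (simp add: mult.assoc nn_integral_cmult)
    then show "(f x * indicator I x) * (\<integral>\<^sup>+t\<in>I. g t \<partial>M) = (\<integral>\<^sup>+t\<in>I. f x * g t \<partial>M) * indicator I x"
      by (simp add: mult_ac)
  qed
  also have "\<dots> \<le> (\<integral>\<^sup>+x\<in>I. (\<integral>\<^sup>+t\<in>I. k x t \<partial>M) \<partial>M)"
    by (intro nn_integral_mono mult_right_mono le) auto
  finally show ?thesis .
qed

text \<open>\<open>R x\<close> and \<open>Ri x\<close> stand for the square root of the weight and for its inverse. Only the real Euclidean
  structure of the values matters, so the values lie in an arbitrary Euclidean space.\<close>

locale A2_weight = R: measurable_form lebesgue R + Ri: measurable_form lebesgue Ri
  for R Ri :: "real^'d \<Rightarrow> 'v \<Rightarrow> 'v::euclidean_space" +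
  fixes A :: real
  assumes sym: "\<And>x u w. R x u \<bullet> w = u \<bullet> R x w"
    and R_Ri: "\<And>x u. R x (Ri x u) = u" and Ri_R: "\<And>x u. Ri x (R x u) = u"
    and A2: "\<And>I. I \<in> cubes \<Longrightarrow>
      (\<integral>\<^sup>+x\<in>I. (\<integral>\<^sup>+t\<in>I. ennreal ((onorm (\<lambda>u. R x (Ri t u)))\<^sup>2) \<partial>lebesgue) \<partial>lebesgue)
        \<le> ennreal A * (emeasure lebesgue I)\<^sup>2"
begin

abbreviation E where "E \<equiv> energy_on lebesgue R"
abbreviation Es where "Es \<equiv> energy_on lebesgue Ri"
abbreviation k where "k x t \<equiv> (onorm (\<lambda>u. R x (Ri t u)))\<^sup>2"

lemma Ri_sym: "Ri x u \<bullet> w = u \<bullet> Ri x w"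
  by (metis R_Ri sym)

lemma bounded_linear_kernel: "bounded_linear (\<lambda>u. R x (Ri t u))"
  using linear_compose[OF Ri.lin[of t] R.lin[of x]] by (simp add: linear_linear o_def)

lemma kernel_bound: "norm (R x (Ri t u)) \<le> onorm (\<lambda>u. R x (Ri t u)) * norm u"
  using onorm[OF bounded_linear_kernel] .

lemma kernel_nonneg: "0 \<le> onorm (\<lambda>u. R x (Ri t u))"
  using onorm_pos_le[OF bounded_linear_kernel] .

text \<open>\<open>Ri t (R x z)\<close> is the adjoint of \<open>R x (Ri t u)\<close> and has the same operator norm. This
  gives the inverse weight the same bounds as the weight, with \<open>x\<close> and \<open>t\<close> exchanged.\<close>

lemma kernel_adjoint_bound: "norm (Ri t (R x z)) \<le> onorm (\<lambda>u. R x (Ri t u)) * norm z"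
proof -
  define w where "w = Ri t (R x z)"
  have "norm w * norm w = w \<bullet> Ri t (R x z)" by (simp add: w_def flip: power2_eq_square dot_square_norm)
  also have "\<dots> = R x (Ri t w) \<bullet> z" by (simp add: Ri_sym[symmetric] sym)
  also have "\<dots> \<le> norm (R x (Ri t w)) * norm z" by (rule norm_cauchy_schwarz)
  also have "\<dots> \<le> (onorm (\<lambda>u. R x (Ri t u)) * norm w) * norm z"
    by (intro mult_right_mono kernel_bound) auto
  finally have "norm w * norm w \<le> norm w * (onorm (\<lambda>u. R x (Ri t u)) * norm z)" by (simp add: mult_ac)
  then show ?thesis
    using kernel_nonneg[of x t] by (cases "norm w = 0") (auto simp: w_def[symmetric] mult_le_cancel_left)
qed

lemma R_le_kernel: "(norm (R x u))\<^sup>2 \<le> k x t * (norm (R t u))\<^sup>2"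
  using power_mono[OF kernel_bound[of x t "R t u"], of 2] by (simp add: Ri_R power_mult_distrib)

lemma Ri_le_kernel: "(norm (Ri t u))\<^sup>2 \<le> k x t * (norm (Ri x u))\<^sup>2"
  using power_mono[OF kernel_adjoint_bound[of t x "Ri x u"], of 2] by (simp add: R_Ri power_mult_distrib)

lemma R_pos: "u \<noteq> 0 \<Longrightarrow> 0 < (norm (R x u))\<^sup>2"
  by (metis Ri_R linear_0[OF Ri.lin] norm_eq_zero zero_less_power2)

lemma Ri_pos: "u \<noteq> 0 \<Longrightarrow> 0 < (norm (Ri x u))\<^sup>2"
  by (metis R_Ri linear_0[OF R.lin] norm_eq_zero zero_less_power2)

lemma R_meas [measurable]: "(\<lambda>x. (norm (R x u))\<^sup>2) \<in> borel_measurable lebesgue"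
  by (rule R.meas) simp

lemma Ri_meas [measurable]: "(\<lambda>x. (norm (Ri x u))\<^sup>2) \<in> borel_measurable lebesgue"
  by (rule Ri.meas) simp

text \<open>Testing the operator norm on \<open>R t u\<close> shows that \<open>\<bar>R x u\<bar>^2\<close> is a scalar $A_2$ weight.\<close>

lemma scalar_A2_R:
  assumes I: "I \<in> cubes" and u: "u \<noteq> 0"
  shows "(\<integral>\<^sup>+x\<in>I. ennreal ((norm (R x u))\<^sup>2) \<partial>lebesgue) * (\<integral>\<^sup>+x\<in>I. ennreal (1 / (norm (R x u))\<^sup>2) \<partial>lebesgue)
    \<le> ennreal A * (emeasure lebesgue I)\<^sup>2"
proof -
  have [measurable]: "I \<in> sets lebesgue" by (rule cubes_lebesgue[OF I])
  have "ennreal ((norm (R x u))\<^sup>2) * ennreal (1 / (norm (R t u))\<^sup>2) \<le> ennreal (k x t)" for x t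
    using R_le_kernel[of x u t] R_pos[OF u, of t] by (simp add: ennreal_mult[symmetric] ennreal_leI divide_le_eq)
  then show ?thesis
    by (intro order_trans[OF product_le_iterated_integral A2[OF I]]) auto
qed

text \<open>The inverse weight is tested through the adjoint; the roles of \<open>x\<close> and \<open>t\<close> are exchanged, and the
  product of the two integrals is symmetric.\<close>

lemma scalar_A2_Ri:
  assumes I: "I \<in> cubes" and u: "u \<noteq> 0"
  shows "(\<integral>\<^sup>+x\<in>I. ennreal ((norm (Ri x u))\<^sup>2) \<partial>lebesgue) * (\<integral>\<^sup>+x\<in>I. ennreal (1 / (norm (Ri x u))\<^sup>2) \<partial>lebesgue)
    \<le> ennreal A * (emeasure lebesgue I)\<^sup>2"
proof -
  have [measurable]: "I \<in> sets lebesgue" by (rule cubes_lebesgue[OF I])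
  have "ennreal (1 / (norm (Ri x u))\<^sup>2) * ennreal ((norm (Ri t u))\<^sup>2) \<le> ennreal (k x t)" for x t
    using Ri_le_kernel[of t u x] Ri_pos[OF u, of x] by (simp add: ennreal_mult[symmetric] ennreal_leI divide_le_eq)
  then have "(\<integral>\<^sup>+x\<in>I. ennreal (1 / (norm (Ri x u))\<^sup>2) \<partial>lebesgue) * (\<integral>\<^sup>+x\<in>I. ennreal ((norm (Ri x u))\<^sup>2) \<partial>lebesgue)
    \<le> ennreal A * (emeasure lebesgue I)\<^sup>2"
    by (intro order_trans[OF product_le_iterated_integral A2[OF I]]) auto
  then show ?thesis by (simp add: mult.commute)
qed

lemma E_zero: "E S (\<lambda>_. 0) = 0" and Es_zero: "Es S (\<lambda>_. 0) = 0"
  by (simp_all add: energy_on_def linear_0[OF R.lin] linear_0[OF Ri.lin])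

lemma
  assumes I: "I \<in> cubes"
  shows E_cube_finite: "E I (\<lambda>_. u) < \<infinity>" and Es_cube_finite: "Es I (\<lambda>_. u) < \<infinity>"
proof -
  show "E I (\<lambda>_. u) < \<infinity>"
  proof (cases "u = 0")
    case False
    show ?thesis
      unfolding energy_on_def
      by (rule scalar_A2(1)[OF R_meas R_pos[OF False] cubes_lebesgue[OF I] emeasure_cubes_nonzero[OF I]
        emeasure_cubes_finite[OF I] scalar_A2_R[OF I False]])
  qed (simp add: E_zero)
  show "Es I (\<lambda>_. u) < \<infinity>"
  proof (cases "u = 0")
    case False
    show ?thesis
      unfolding energy_on_def
      by (rule scalar_A2(1)[OF Ri_meas Ri_pos[OF False] cubes_lebesgue[OF I] emeasure_cubes_nonzero[OF I]
        emeasure_cubes_finite[OF I] scalar_A2_Ri[OF I False]])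
  qed (simp add: Es_zero)
qed

lemma A_ge_1: "1 \<le> A"
proof -
  obtain u :: 'v where u: "u \<noteq> 0" using nonzero_Basis[OF SOME_Basis] by blast
  have I: "half_open_cube 0 1 \<in> (cubes :: (real^'d) set set)" by (force simp: cubes_def)
  show ?thesis
    by (rule scalar_A2(2)[OF R_meas R_pos[OF u] cubes_lebesgue[OF I] emeasure_cubes_nonzero[OF I]
        emeasure_cubes_finite[OF I] scalar_A2_R[OF I u]])
qed

lemma
  assumes I: "I \<in> cubes" and S: "S \<in> sets lebesgue" "S \<subseteq> I" "emeasure lebesgue I \<le> 2 * emeasure lebesgue S"
  shows E_doubling: "E I (\<lambda>_. u) \<le> ennreal (4 * A) * E S (\<lambda>_. u)"
    and Es_doubling: "Es I (\<lambda>_. u) \<le> ennreal (4 * A) * Es S (\<lambda>_. u)"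
proof -
  show "E I (\<lambda>_. u) \<le> ennreal (4 * A) * E S (\<lambda>_. u)"
  proof (cases "u = 0")
    case False
    show ?thesis
      unfolding energy_on_def
      by (rule scalar_A2(3)[OF R_meas R_pos[OF False] cubes_lebesgue[OF I] emeasure_cubes_nonzero[OF I]
        emeasure_cubes_finite[OF I] scalar_A2_R[OF I False] S])
  qed (simp add: E_zero)
  show "Es I (\<lambda>_. u) \<le> ennreal (4 * A) * Es S (\<lambda>_. u)"
  proof (cases "u = 0")
    case False
    show ?thesis
      unfolding energy_on_def
      by (rule scalar_A2(3)[OF Ri_meas Ri_pos[OF False] cubes_lebesgue[OF I] emeasure_cubes_nonzero[OF I]
        emeasure_cubes_finite[OF I] scalar_A2_Ri[OF I False] S])
  qed (simp add: Es_zero)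
qed

text \<open>The bilinear form \<open>\<langle>V_I v, u\<rangle>\<close> of the integrated inverse weight.\<close>

definition dual_form :: "(real^'d) set \<Rightarrow> 'v \<Rightarrow> 'v \<Rightarrow> real" where
  "dual_form I v u = (LINT t:I|lebesgue. Ri t v \<bullet> Ri t u)"

lemma Ri_polarization:
  "Ri t v \<bullet> Ri t u = ((norm (Ri t (v + u)))\<^sup>2 - (norm (Ri t (v - u)))\<^sup>2) / 4"
  by (simp add: linear_add[OF Ri.lin] linear_diff[OF Ri.lin] power2_norm_eq_inner inner_add_left
      inner_add_right inner_diff_left inner_diff_right inner_commute)

lemma set_integrable_Ri_square:
  assumes I: "I \<in> cubes"
  shows "set_integrable lebesgue I (\<lambda>t. (norm (Ri t v))\<^sup>2)"
  unfolding set_integrable_def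
proof (rule integrableI_nonneg)
  have [measurable]: "I \<in> sets lebesgue" by (rule cubes_lebesgue[OF I])
  show "(\<lambda>x. indicat_real I x *\<^sub>R (norm (Ri x v))\<^sup>2) \<in> borel_measurable lebesgue" by simp
  have "(\<integral>\<^sup>+ x. ennreal (indicat_real I x *\<^sub>R (norm (Ri x v))\<^sup>2) \<partial>lebesgue) = Es I (\<lambda>_. v)"
    unfolding energy_on_def by (intro nn_integral_cong) (auto split: split_indicator)
  then show "(\<integral>\<^sup>+ x. ennreal (indicat_real I x *\<^sub>R (norm (Ri x v))\<^sup>2) \<partial>lebesgue) < \<infinity>"
    using Es_cube_finite[OF I, of v] by simp
qed simp

lemma set_integrable_Ri_inner:
  assumes I: "I \<in> cubes"
  shows "set_integrable lebesgue I (\<lambda>t. Ri t v \<bullet> Ri t u)"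
  unfolding Ri_polarization
    using set_integral_diff(1)[OF set_integrable_Ri_square[OF I] set_integrable_Ri_square[OF I], of "v + u" "v - u"]
  by simp

lemma Es_eq_dual_form:
  assumes I: "I \<in> cubes"
  shows "Es I (\<lambda>_. v) = ennreal (dual_form I v v)" and "0 \<le> dual_form I v v"
proof -
  have "Es I (\<lambda>_. v) = (\<integral>\<^sup>+ x. ennreal (indicat_real I x *\<^sub>R (norm (Ri x v))\<^sup>2) \<partial>lebesgue)"
    unfolding energy_on_def by (intro nn_integral_cong) (auto split: split_indicator)
  also have "\<dots> = ennreal (dual_form I v v)"
    using set_integrable_Ri_square[OF I, of v] unfolding dual_form_def set_lebesgue_integral_def set_integrable_def
    by (subst nn_integral_eq_integral) (auto simp: power2_norm_eq_inner)
  finally show "Es I (\<lambda>_. v) = ennreal (dual_form I v v)" .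
  show "0 \<le> dual_form I v v"
    unfolding dual_form_def set_lebesgue_integral_def by (intro Bochner_Integration.integral_nonneg) auto
qed

lemma dual_form_linear:
  assumes I: "I \<in> cubes"
  shows "dual_form I (v + v') u = dual_form I v u + dual_form I v' u" "dual_form I (c *\<^sub>R v) u = c * dual_form I v u" "dual_form I v u = dual_form I u v"
proof -
  show "dual_form I (v + v') u = dual_form I v u + dual_form I v' u"
    using set_integral_add(2)[OF set_integrable_Ri_inner[OF I] set_integrable_Ri_inner[OF I], of v u v' u]
    by (simp add: dual_form_def linear_add[OF Ri.lin] inner_add_left)
  show "dual_form I (c *\<^sub>R v) u = c * dual_form I v u" by (simp add: dual_form_def linear_scale[OF Ri.lin])
  show "dual_form I v u = dual_form I u v" by (simp add: dual_form_def inner_commute)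
qed

lemma dual_form_pos:
  assumes I: "I \<in> cubes" and v: "v \<noteq> 0"
  shows "0 < dual_form I v v"
proof (rule ccontr)
  have [measurable]: "I \<in> sets lebesgue" by (rule cubes_lebesgue[OF I])
  assume "\<not> 0 < dual_form I v v"
  then have "Es I (\<lambda>_. v) = 0" using Es_eq_dual_form[OF I, of v] by (simp add: ennreal_eq_0_iff)
  then have "AE x in lebesgue. ennreal ((norm (Ri x v))\<^sup>2) * indicator I x = 0"
    unfolding energy_on_def by (subst (asm) nn_integral_0_iff_AE) auto
  then have "AE x in lebesgue. x \<notin> I"
    using Ri_pos[OF v] by (elim eventually_mono) (auto simp: indicator_def ennreal_eq_0_iff not_le split: if_splits)
  then show False
    using emeasure_cubes_nonzero[OF I] by (auto simp flip: AE_iff_null_sets[OF cubes_lebesgue[OF I]])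
qed

lemma dual_form_Cauchy_Schwarz:
  assumes I: "I \<in> cubes"
  shows "(dual_form I v u)\<^sup>2 \<le> dual_form I v v * dual_form I u u"
proof (cases "v = 0")
  case True
  then have "dual_form I v u = 0" using dual_form_linear(2)[OF I, of 0 v u] by simp
  then show ?thesis using Es_eq_dual_form(2)[OF I] by simp
next
  case False
  \<comment> \<open>the minimizer of the form along the line \<open>u - s v\<close>\<close>
  define s where "s = dual_form I v u / dual_form I v v"
  have p: "0 < dual_form I v v" by (rule dual_form_pos[OF I False])
  have "0 \<le> dual_form I (u + (- s) *\<^sub>R v) (u + (- s) *\<^sub>R v)" by (rule Es_eq_dual_form(2)[OF I])
  also have "\<dots> = dual_form I u u - 2 * s * dual_form I v u + s\<^sup>2 * dual_form I v v"
  proof -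
    have l: "dual_form I (u + (- s) *\<^sub>R v) w = dual_form I u w - s * dual_form I v w" for w
      by (simp only: dual_form_linear(1,2)[OF I])
    have r: "dual_form I w (u + (- s) *\<^sub>R v) = dual_form I w u - s * dual_form I w v" for w
      by (metis dual_form_linear(3)[OF I] l)
    show ?thesis
      unfolding l r dual_form_linear(3)[OF I, of u v] by (simp add: power2_eq_square algebra_simps)
  qed
  also have "\<dots> = dual_form I u u - (dual_form I v u)\<^sup>2 / dual_form I v v"
    using p by (simp add: s_def power2_eq_square field_simps)
  finally show ?thesis using p by (simp add: field_simps)
qed

text \<open>The form is an inner product on a finite-dimensional space, so it represents every functional; this
  solves \<open>V_I v = y\<close>.\<close>

lemma dual_form_representation:
  assumes I: "I \<in> cubes"
  obtains v where "\<And>u. dual_form I v u = y \<bullet> u"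
proof -
  define T where "T v = (\<Sum>b\<in>Basis. dual_form I v b *\<^sub>R b)" for v
  have linT: "linear T"
    by (intro linearI) (simp_all add: T_def dual_form_linear(1,2)[OF I] sum.distrib scaleR_left_distrib scaleR_sum_right)
  have T: "T v \<bullet> u = dual_form I v u" for v u
  proof -
    have l: "linear (\<lambda>u. dual_form I v u)"
      by (intro linearI) (metis dual_form_linear(1,3)[OF I], metis dual_form_linear(2,3)[OF I] real_scaleR_def)
    have "dual_form I v u = dual_form I v (\<Sum>b\<in>Basis. (u \<bullet> b) *\<^sub>R b)" by (simp add: euclidean_representation)
    also have "\<dots> = (\<Sum>b\<in>Basis. (u \<bullet> b) * dual_form I v b)" by (simp add: linear_sum[OF l] linear_scale[OF l])
    also have "\<dots> = T v \<bullet> u" by (simp add: T_def inner_sum_left inner_commute[of u] mult.commute)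
    finally show ?thesis by simp
  qed
  have "inj T"
  proof (rule linear_injective_0[THEN iffD2, OF linT, rule_format])
    fix v assume "T v = 0"
    then have "dual_form I v v = 0" using T[of v v] by simp
    then show "v = 0" using dual_form_pos[OF I, of v] by fastforce
  qed
  then have "surj T" using linear_injective_imp_surjective[OF linT] by blast
  then obtain v where "T v = y" by (metis surjD)
  then show ?thesis using T that by metis
qed

text \<open>This is \<open>W_I \<le> A \<bar>I\<bar>^2 (V_I)^{-1}\<close> with \<open>y = V_I v\<close>. For fixed \<open>x\<close> put \<open>z = R x y\<close>. Then
  \<open>\<bar>z\<bar>^2 = \<langle>V_I v, R x z\<rangle>\<close>, and Cauchy-Schwarz for the form \<open>V_I\<close> leaves \<open>\<langle>V_I R x z, R x z\<rangle>\<close>, the integral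
  over \<open>t\<close> of \<open>\<bar>Ri t (R x z)\<bar>^2\<close>, which the kernel bounds by \<open>\<bar>z\<bar>^2\<close> times its inner integral. Hence
  \<open>\<bar>R x y\<bar>^2 / \<langle>V_I v, v\<rangle>\<close> is at most the inner integral at \<open>x\<close>. The quotient is formed before integrating
  in \<open>x\<close> because the inner integral need not be measurable in \<open>x\<close>.\<close>

lemma E_le_Es:
  assumes I: "I \<in> cubes" and v: "\<And>u. dual_form I v u = y \<bullet> u"
  shows "E I (\<lambda>_. y) \<le> ennreal A * (emeasure lebesgue I)\<^sup>2 * Es I (\<lambda>_. v)"
proof (cases "v = 0")
  case True
  then have "y \<bullet> y = 0" using v[of y] dual_form_linear(2)[OF I, of 0 v y] by simp
  then show ?thesis by (simp add: E_zero)
next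
  case False
  have Is [measurable]: "I \<in> sets lebesgue" by (rule cubes_lebesgue[OF I])
  define c where "c = dual_form I v v"
  have c: "0 < c" unfolding c_def by (rule dual_form_pos[OF I False])
  have pt: "ennreal ((norm (R x y))\<^sup>2 / c) \<le> (\<integral>\<^sup>+t\<in>I. ennreal (k x t) \<partial>lebesgue)" for x
  proof (cases "R x y = 0")
    case False
    define z where "z = R x y"
    define n where "n = (norm z)\<^sup>2"
    have n: "0 < n" using False by (simp add: n_def z_def)
    define u where "u = R x z"
    have "n = dual_form I v u"
      by (simp add: v n_def u_def z_def power2_norm_eq_inner sym)
    then have "n\<^sup>2 \<le> c * dual_form I u u" using dual_form_Cauchy_Schwarz[OF I, of v u] by (simp add: c_def)
    then have "n / c \<le> dual_form I u u / n" using n c by (simp add: field_simps power2_eq_square)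
    then have "ennreal (n / c) \<le> ennreal (1 / n) * Es I (\<lambda>_. u)"
      using n Es_eq_dual_form[OF I, of u] by (simp add: ennreal_mult[symmetric] ennreal_leI)
    also have "\<dots> = (\<integral>\<^sup>+t. ennreal (1 / n) * (ennreal ((norm (Ri t u))\<^sup>2) * indicator I t) \<partial>lebesgue)"
      unfolding energy_on_def by (simp add: nn_integral_cmult)
    also have "\<dots> \<le> (\<integral>\<^sup>+t\<in>I. ennreal (k x t) \<partial>lebesgue)"
    proof (rule nn_integral_mono)
      fix t
      have "(norm (Ri t u))\<^sup>2 \<le> k x t * n"
        using power_mono[OF kernel_adjoint_bound[of t x z], of 2] by (simp add: u_def n_def power_mult_distrib)
      then have "ennreal (1 / n) * ennreal ((norm (Ri t u))\<^sup>2) \<le> ennreal (k x t)"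
        using n by (simp add: ennreal_mult[symmetric] ennreal_leI divide_le_eq)
      then show "ennreal (1 / n) * (ennreal ((norm (Ri t u))\<^sup>2) * indicator I t) \<le> ennreal (k x t) * indicator I t"
        by (auto split: split_indicator)
    qed
    finally show ?thesis by (simp add: n_def z_def)
  qed simp
  have "E I (\<lambda>_. y) = (\<integral>\<^sup>+x. ennreal c * (ennreal ((norm (R x y))\<^sup>2 / c) * indicator I x) \<partial>lebesgue)"
    unfolding energy_on_def
  proof (intro nn_integral_cong)
    fix x
    have "ennreal ((norm (R x y))\<^sup>2) = ennreal c * ennreal ((norm (R x y))\<^sup>2 / c)"
      using c by (simp add: ennreal_mult[symmetric])
    then show "ennreal ((norm (R x y))\<^sup>2) * indicator I x = ennreal c * (ennreal ((norm (R x y))\<^sup>2 / c) * indicator I x)"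
      by (simp add: mult.assoc)
  qed
  also have "\<dots> = ennreal c * (\<integral>\<^sup>+x\<in>I. ennreal ((norm (R x y))\<^sup>2 / c) \<partial>lebesgue)"
    by (intro nn_integral_cmult) simp
  also have "\<dots> \<le> ennreal c * (\<integral>\<^sup>+x\<in>I. (\<integral>\<^sup>+t\<in>I. ennreal (k x t) \<partial>lebesgue) \<partial>lebesgue)"
    by (intro mult_left_mono nn_integral_mono mult_right_mono pt) auto
  also have "\<dots> \<le> ennreal c * (ennreal A * (emeasure lebesgue I)\<^sup>2)"
    by (intro mult_left_mono A2 I) auto
  finally show ?thesis using Es_eq_dual_form(1)[OF I, of v] by (simp add: c_def mult_ac)
qed

end

section \<open>Finite sparse sums\<close>

locale sparse_A2_weight = A2_weight R Ri A + sparse_family D G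
  for R Ri :: "real^'d \<Rightarrow> 'v \<Rightarrow> 'v::euclidean_space" and A and D G :: "(real^'d) set set"
begin

lemma
  assumes F: "finite F" "F \<subseteq> G"
  shows E_embedding: "E UNIV (\<lambda>x. \<Sum>J\<in>F. indicator J x *\<^sub>R v J) \<le> ennreal (16 * A) * (\<Sum>J\<in>F. E J (\<lambda>_. v J))"
    and Es_embedding: "Es UNIV (\<lambda>x. \<Sum>J\<in>F. indicator J x *\<^sub>R v J) \<le> ennreal (16 * A) * (\<Sum>J\<in>F. Es J (\<lambda>_. v J))"
proof -
  have cube: "J \<in> cubes" if "J \<in> F" for J using member_cubes that F(2) by blast
  have sets: "F \<subseteq> sets lebesgue" using cubes_lebesgue[OF cube] by blast
  have nest: "I \<inter> J = {} \<or> I \<subseteq> J \<or> J \<subseteq> I" if "I \<in> F" "J \<in> F" for I J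
    using members_nested[of I J] that F(2) by blast
  have ne: "{} \<notin> F" using cubes_interior[OF cube] by force
  have core: "core G J \<in> sets lebesgue" "core G J \<subseteq> J"
    "emeasure lebesgue J \<le> 2 * emeasure lebesgue (core G J)" if "J \<in> F" for J
    using that F(2) core_sets emeasure_core by (auto simp: core_def)
  have "E UNIV (\<lambda>x. \<Sum>J\<in>F. indicator J x *\<^sub>R v J) \<le> ennreal (4 * (4 * A)) * (\<Sum>J\<in>F. E J (\<lambda>_. v J))"
  proof (rule R.carleson_embedding[OF _ F(1) sets nest ne])
    show "E I (\<lambda>_. u) < \<infinity>" if "I \<in> F" for I u by (rule E_cube_finite[OF cube[OF that]])
    show "(\<Sum>J\<in>{J\<in>F. J \<subseteq> I}. E J (\<lambda>_. u)) \<le> ennreal (4 * A) * E I (\<lambda>_. u)" if "I \<in> F" for I u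
      using carleson_of_core[OF F, where w = "\<lambda>x. ennreal ((norm (R x u))\<^sup>2)" and K = "4 * A" and I = I]
        E_doubling[OF cube core, of _ u] unfolding energy_on_def by simp
  qed (use A_ge_1 in auto)
  then show "E UNIV (\<lambda>x. \<Sum>J\<in>F. indicator J x *\<^sub>R v J) \<le> ennreal (16 * A) * (\<Sum>J\<in>F. E J (\<lambda>_. v J))"
    by simp
  have "Es UNIV (\<lambda>x. \<Sum>J\<in>F. indicator J x *\<^sub>R v J) \<le> ennreal (4 * (4 * A)) * (\<Sum>J\<in>F. Es J (\<lambda>_. v J))"
  proof (rule Ri.carleson_embedding[OF _ F(1) sets nest ne])
    show "Es I (\<lambda>_. u) < \<infinity>" if "I \<in> F" for I u by (rule Es_cube_finite[OF cube[OF that]])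
    show "(\<Sum>J\<in>{J\<in>F. J \<subseteq> I}. Es J (\<lambda>_. u)) \<le> ennreal (4 * A) * Es I (\<lambda>_. u)" if "I \<in> F" for I u
      using carleson_of_core[OF F, where w = "\<lambda>x. ennreal ((norm (Ri x u))\<^sup>2)" and K = "4 * A" and I = I]
        Es_doubling[OF cube core, of _ u] unfolding energy_on_def by simp
  qed (use A_ge_1 in auto)
  then show "Es UNIV (\<lambda>x. \<Sum>J\<in>F. indicator J x *\<^sub>R v J) \<le> ennreal (16 * A) * (\<Sum>J\<in>F. Es J (\<lambda>_. v J))"
    by simp
qed

text \<open>The pairing between \<open>L2(W)\<close> and \<open>L2(W^{-1})\<close> at a single point.\<close>

lemma inner_le_energies: "\<bar>a \<bullet> b\<bar> \<le> norm (R x a) * norm (Ri x b)"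
proof -
  have "a \<bullet> b = R x a \<bullet> Ri x b" by (simp add: sym R_Ri)
  then show ?thesis by (metis Cauchy_Schwarz_ineq2)
qed

definition mean :: "(real^'d \<Rightarrow> 'v) \<Rightarrow> (real^'d) set \<Rightarrow> 'v" where
  "mean f I = (1 / measure lebesgue I) *\<^sub>R (LINT x:I|lebesgue. f x)"

context
  fixes f :: "real^'d \<Rightarrow> 'v"
  assumes f [measurable]: "f \<in> borel_measurable lebesgue" and f_fin: "E UNIV f < \<infinity>"
begin

text \<open>Each coordinate of \<open>f\<close> pairs \<open>f\<close> with a basis vector, which has finite energy for the inverse weight
  on the cube.\<close>

lemma set_integrable_f:
  assumes I: "I \<in> cubes"
  shows "set_integrable lebesgue I f"
  unfolding set_integrable_def
proof (rule integrableI_bounded)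
  have [measurable]: "I \<in> sets lebesgue" by (rule cubes_lebesgue[OF I])
  show "(\<lambda>x. indicat_real I x *\<^sub>R f x) \<in> borel_measurable lebesgue" by simp
  have Rf: "(\<lambda>x. (norm (R x (f x)))\<^sup>2) \<in> borel_measurable lebesgue" by (rule R.meas[OF f])
  have pt: "norm (f x) \<le> (\<Sum>b\<in>Basis. (norm (R x (f x)))\<^sup>2 + (norm (Ri x b))\<^sup>2)" for x
  proof (rule order_trans[OF norm_le_l1] , rule sum_mono)
    fix b :: 'v
    have "\<bar>f x \<bullet> b\<bar> \<le> norm (R x (f x)) * norm (Ri x b)" by (rule inner_le_energies)
    also have "\<dots> \<le> (norm (R x (f x)))\<^sup>2 + (norm (Ri x b))\<^sup>2"
      using sum_squares_bound[of "norm (R x (f x))" "norm (Ri x b)"]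
        mult_nonneg_nonneg[OF norm_ge_zero norm_ge_zero, of "R x (f x)" "Ri x b"] by linarith
    finally show "\<bar>f x \<bullet> b\<bar> \<le> (norm (R x (f x)))\<^sup>2 + (norm (Ri x b))\<^sup>2" .
  qed
  have "(\<integral>\<^sup>+ x. ennreal (norm (indicat_real I x *\<^sub>R f x)) \<partial>lebesgue)
    \<le> (\<integral>\<^sup>+ x. (\<Sum>b\<in>(Basis :: 'v set). ennreal ((norm (R x (f x)))\<^sup>2) * indicator I x + ennreal ((norm (Ri x b))\<^sup>2) * indicator I x) \<partial>lebesgue)"
  proof (rule nn_integral_mono)
    fix x
    have "ennreal (norm (f x)) \<le> ennreal (\<Sum>b\<in>(Basis :: 'v set). (norm (R x (f x)))\<^sup>2 + (norm (Ri x b))\<^sup>2)"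
      using pt by (rule ennreal_leI)
    also have "\<dots> = (\<Sum>b\<in>(Basis :: 'v set). ennreal ((norm (R x (f x)))\<^sup>2) + ennreal ((norm (Ri x b))\<^sup>2))"
      by (simp add: ennreal_plus[symmetric] sum_ennreal del: ennreal_plus)
    finally show "ennreal (norm (indicat_real I x *\<^sub>R f x)) \<le> (\<Sum>b\<in>(Basis :: 'v set). ennreal ((norm (R x (f x)))\<^sup>2) * indicator I x + ennreal ((norm (Ri x b))\<^sup>2) * indicator I x)"
      by (auto split: split_indicator)
  qed
  also have "\<dots> = (\<Sum>b\<in>(Basis :: 'v set). E I f + Es I (\<lambda>_. b))"
    unfolding energy_on_def using Rf by (simp add: nn_integral_sum nn_integral_add)
  also have "\<dots> < \<infinity>"
    using Es_cube_finite[OF I] le_less_trans[OF energy_on_mono[of I UNIV] f_fin] by (simp add: ennreal_add_less_top)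
  finally show "(\<integral>\<^sup>+ x. ennreal (norm (indicat_real I x *\<^sub>R f x)) \<partial>lebesgue) < \<infinity>" .
qed

text \<open>With \<open>X\<close> the sum of the dual energies of the solutions \<open>v I\<close>, the duality argument gives
  \<open>X \<le> (l/2) \<parallel>f\<parallel>^2 + X/2\<close> for \<open>l = 16 A\<close>. As \<open>X\<close> is finite, it can be absorbed on the left.\<close>

lemma sum_mean_energy:
  assumes F: "finite F" "F \<subseteq> G"
  shows "(\<Sum>I\<in>F. E I (\<lambda>_. mean f I)) \<le> ennreal (16 * A\<^sup>2) * E UNIV f"
proof -
  have cube: "J \<in> cubes" if "J \<in> F" for J using member_cubes that F(2) by blast
  have sets: "J \<in> sets lebesgue" if "J \<in> F" for J using cubes_lebesgue[OF cube[OF that]] .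
  define y where "y I = (LINT x:I|lebesgue. f x)" for I
  have "\<forall>I\<in>F. \<exists>v. \<forall>u. dual_form I v u = y I \<bullet> u" using dual_form_representation[OF cube] by metis
  then obtain v where v: "\<And>I u. I \<in> F \<Longrightarrow> dual_form I (v I) u = y I \<bullet> u" by metis
  have Es_v: "Es I (\<lambda>_. v I) = ennreal (y I \<bullet> v I)" "0 \<le> y I \<bullet> v I" if "I \<in> F" for I
    using Es_eq_dual_form[OF cube[OF that], of "v I"] v[OF that] by auto
  define X where "X = (\<Sum>I\<in>F. y I \<bullet> v I)"
  have X0: "0 \<le> X" unfolding X_def by (intro sum_nonneg Es_v)
  define s where "s x = (\<Sum>J\<in>F. indicator J x *\<^sub>R v J)" for x
  have sm [measurable]: "s \<in> borel_measurable lebesgue"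
    unfolding s_def using sets by (intro borel_measurable_sum borel_measurable_scaleR borel_measurable_indicator) auto
  have Es_s: "Es UNIV s \<le> ennreal (16 * A * X)"
  proof -
    have "Es UNIV s \<le> ennreal (16 * A) * (\<Sum>J\<in>F. Es J (\<lambda>_. v J))"
      unfolding s_def by (rule Es_embedding[OF F])
    also have "(\<Sum>J\<in>F. Es J (\<lambda>_. v J)) = ennreal X"
      unfolding X_def using Es_v by (simp add: sum_ennreal)
    finally show ?thesis using A_ge_1 X0 by (simp add: ennreal_mult)
  qed
  have int: "integrable lebesgue (\<lambda>x. f x \<bullet> (indicat_real J x *\<^sub>R v J))"
    and int_eq: "(LINT x|lebesgue. f x \<bullet> (indicat_real J x *\<^sub>R v J)) = y J \<bullet> v J" if "J \<in> F" for J
  proof -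
    have i: "integrable lebesgue (\<lambda>x. indicat_real J x *\<^sub>R f x)"
      using set_integrable_f[OF cube[OF that]] by (simp add: set_integrable_def)
    have e: "f x \<bullet> (indicat_real J x *\<^sub>R v J) = (indicat_real J x *\<^sub>R f x) \<bullet> v J" for x by simp
    show "integrable lebesgue (\<lambda>x. f x \<bullet> (indicat_real J x *\<^sub>R v J))"
      unfolding e by (rule integrable_inner_left[OF i])
    show "(LINT x|lebesgue. f x \<bullet> (indicat_real J x *\<^sub>R v J)) = y J \<bullet> v J"
      unfolding e y_def set_lebesgue_integral_def by (rule integral_inner_left[OF i])
  qed
  have fs: "f x \<bullet> s x = (\<Sum>J\<in>F. f x \<bullet> (indicat_real J x *\<^sub>R v J))" for x
    unfolding s_def by (simp only: inner_sum_right)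
  have ints: "integrable lebesgue (\<lambda>x. f x \<bullet> s x)" and Xs: "(LINT x|lebesgue. f x \<bullet> s x) = X"
    unfolding fs X_def using int int_eq by (auto simp: Bochner_Integration.integral_sum simp del: inner_scaleR_right)
  define a where "a = enn2real (E UNIV f)"
  have a: "E UNIV f = ennreal a" "0 \<le> a" using f_fin by (auto simp: a_def less_top)
  \<comment> \<open>the weight in the inequality of arithmetic and geometric means, matched to the embedding constant\<close>
  define l where "l = 16 * A"
  have l: "0 < l" using A_ge_1 by (simp add: l_def)
  have Rf: "(\<lambda>x. (norm (R x (f x)))\<^sup>2) \<in> borel_measurable lebesgue" by (rule R.meas[OF f])
  have Rs: "(\<lambda>x. (norm (Ri x (s x)))\<^sup>2) \<in> borel_measurable lebesgue" by (rule Ri.meas[OF sm])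
  have "ennreal X \<le> (\<integral>\<^sup>+x. ennreal \<bar>f x \<bullet> s x\<bar> \<partial>lebesgue)"
  proof -
    have "X \<le> (LINT x|lebesgue. \<bar>f x \<bullet> s x\<bar>)"
      unfolding Xs[symmetric] by (intro integral_mono ints integrable_abs) auto
    then have "ennreal X \<le> ennreal (LINT x|lebesgue. \<bar>f x \<bullet> s x\<bar>)" by (rule ennreal_leI)
    also have "\<dots> = (\<integral>\<^sup>+x. ennreal \<bar>f x \<bullet> s x\<bar> \<partial>lebesgue)"
      by (intro nn_integral_eq_integral[symmetric] integrable_abs ints) auto
    finally show ?thesis .
  qed
  also have "\<dots> \<le> (\<integral>\<^sup>+x. ennreal (l / 2) * ennreal ((norm (R x (f x)))\<^sup>2) + ennreal (1 / (2 * l)) * ennreal ((norm (Ri x (s x)))\<^sup>2) \<partial>lebesgue)"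
  proof (rule nn_integral_mono)
    fix x
    define p q where "p = norm (R x (f x))" and "q = norm (Ri x (s x))"
    have "\<bar>f x \<bullet> s x\<bar> \<le> p * q" unfolding p_def q_def by (rule inner_le_energies)
    also have "p * q \<le> (l / 2) * p\<^sup>2 + (1 / (2 * l)) * q\<^sup>2"
    proof -
      have "0 \<le> (l * p - q)\<^sup>2 / (2 * l)" using l by simp
      also have "\<dots> = (l / 2) * p\<^sup>2 + (1 / (2 * l)) * q\<^sup>2 - p * q"
        using l by (simp add: power2_eq_square field_simps)
      finally show ?thesis by simp
    qed
    finally have "ennreal \<bar>f x \<bullet> s x\<bar> \<le> ennreal ((l / 2) * p\<^sup>2 + (1 / (2 * l)) * q\<^sup>2)" by (rule ennreal_leI)
    also have "\<dots> = ennreal (l / 2) * ennreal (p\<^sup>2) + ennreal (1 / (2 * l)) * ennreal (q\<^sup>2)"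
      using l by (simp flip: ennreal_mult)
    finally show "ennreal \<bar>f x \<bullet> s x\<bar> \<le> ennreal (l / 2) * ennreal ((norm (R x (f x)))\<^sup>2) + ennreal (1 / (2 * l)) * ennreal ((norm (Ri x (s x)))\<^sup>2)"
      by (simp add: p_def q_def)
  qed
  also have "\<dots> = ennreal (l / 2) * E UNIV f + ennreal (1 / (2 * l)) * Es UNIV s"
    unfolding energy_on_def using Rf Rs by (simp add: nn_integral_add nn_integral_cmult)
  also have "\<dots> \<le> ennreal (l / 2) * ennreal a + ennreal (1 / (2 * l)) * ennreal (l * X)"
    using Es_s by (intro add_mono mult_left_mono) (auto simp: a l_def)
  also have "\<dots> = ennreal ((l / 2) * a + (1 / (2 * l)) * (l * X))"
    using l a X0 by (simp flip: ennreal_mult)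
  finally have "X \<le> (l / 2) * a + (1 / (2 * l)) * (l * X)"
    using l a X0 by (simp add: ennreal_le_iff del: ennreal_plus)
  then have Xa: "X \<le> l * a" using l by simp
  have "E I (\<lambda>_. mean f I) \<le> ennreal (A * (y I \<bullet> v I))" if "I \<in> F" for I
  proof -
    define c where "c = measure lebesgue I"
    have em: "emeasure lebesgue I = ennreal c"
      unfolding c_def using emeasure_cubes_finite[OF cube[OF that]] by (simp add: emeasure_eq_ennreal_measure)
    then have c: "0 < c" using emeasure_cubes_nonzero[OF cube[OF that]]
      by (simp add: c_def) (metis measure_nonneg less_eq_real_def)
    have "E I (\<lambda>_. mean f I) = (\<integral>\<^sup>+x. ennreal ((1 / c)\<^sup>2) * (ennreal ((norm (R x (y I)))\<^sup>2) * indicator I x) \<partial>lebesgue)"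
      unfolding energy_on_def
      by (intro nn_integral_cong) (simp add: mean_def y_def c_def linear_scale[OF R.lin] power_mult_distrib
          ennreal_mult[symmetric] power_divide split: split_indicator)
    also have "\<dots> = ennreal ((1 / c)\<^sup>2) * E I (\<lambda>_. y I)"
      unfolding energy_on_def using sets[OF that] by (intro nn_integral_cmult) simp
    also have "\<dots> \<le> ennreal ((1 / c)\<^sup>2) * (ennreal A * (emeasure lebesgue I)\<^sup>2 * Es I (\<lambda>_. v I))"
      by (intro mult_left_mono E_le_Es cube that v) auto
    also have "\<dots> = ennreal ((1 / c)\<^sup>2 * (A * c\<^sup>2 * (y I \<bullet> v I)))"
      using c A_ge_1 Es_v[OF that] by (simp add: em ennreal_mult ennreal_power)
    also have "(1 / c)\<^sup>2 * (A * c\<^sup>2 * (y I \<bullet> v I)) = A * (y I \<bullet> v I)"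
      using c by (simp add: power2_eq_square)
    finally show ?thesis .
  qed
  then have "(\<Sum>I\<in>F. E I (\<lambda>_. mean f I)) \<le> (\<Sum>I\<in>F. ennreal (A * (y I \<bullet> v I)))"
    by (rule sum_mono)
  also have "\<dots> = ennreal (A * X)"
    unfolding X_def sum_distrib_left using Es_v A_ge_1 by (subst sum_ennreal) auto
  also have "\<dots> \<le> ennreal (A * (l * a))"
    using Xa A_ge_1 by (intro ennreal_leI mult_left_mono) auto
  also have "\<dots> = ennreal (16 * A\<^sup>2) * E UNIV f"
    using a A_ge_1 by (simp add: l_def ennreal_mult[symmetric] power2_eq_square mult_ac)
  finally show ?thesis .
qed

end
end

section \<open>Unconditional convergence of the sparse sum\<close>

context sparse_A2_weight
begin

context
  fixes f :: "real^'d \<Rightarrow> 'v"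
  assumes f [measurable]: "f \<in> borel_measurable lebesgue" and f_fin: "E UNIV f < \<infinity>"
begin

definition mean_sum :: "(real^'d) set set \<Rightarrow> real^'d \<Rightarrow> 'v" where
  "mean_sum F x = (\<Sum>I\<in>F. indicator I x *\<^sub>R mean f I)"

definition mean_energy :: "(real^'d) set \<Rightarrow> real" where
  "mean_energy I = enn2real (E I (\<lambda>_. mean f I))"

lemma mean_energy_nonneg: "0 \<le> mean_energy I"
  by (simp add: mean_energy_def)

lemma mean_energy_eq: "I \<in> G \<Longrightarrow> E I (\<lambda>_. mean f I) = ennreal (mean_energy I)"
  using E_cube_finite[OF member_cubes, of I "mean f I"] by (simp add: mean_energy_def less_top)

lemma mean_sum_meas [measurable]: "F \<subseteq> G \<Longrightarrow> mean_sum F \<in> borel_measurable lebesgue"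
  unfolding mean_sum_def[abs_def] using cubes_lebesgue[OF member_cubes]
  by (intro borel_measurable_sum borel_measurable_scaleR borel_measurable_indicator) auto

text \<open>The difference of two partial sums is a sum over the symmetric difference of the index sets with
  coefficients \<open>mean f I\<close> and \<open>- mean f I\<close>, and the embedding does not see the signs.\<close>

lemma energy_mean_sum_diff:
  assumes F: "finite F" "F \<subseteq> G" and F': "finite F'" "F' \<subseteq> G"
  shows "E UNIV (\<lambda>x. mean_sum F x - mean_sum F' x) \<le> ennreal (16 * A * (sum mean_energy (F - F') + sum mean_energy (F' - F)))"
proof -
  let ?H = "(F - F') \<union> (F' - F)"
  define v where "v I = (if I \<in> F then mean f I else - mean f I)" for I
  have H: "finite ?H" "?H \<subseteq> G" using F F' by auto
  have "mean_sum F x - mean_sum F' x = (\<Sum>I\<in>?H. indicator I x *\<^sub>R v I)" for x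
  proof -
    have "mean_sum F x = (\<Sum>I\<in>F \<inter> F'. indicator I x *\<^sub>R mean f I) + (\<Sum>I\<in>F - F'. indicator I x *\<^sub>R mean f I)"
      unfolding mean_sum_def by (rule sum.Int_Diff[OF F(1)])
    moreover have "mean_sum F' x = (\<Sum>I\<in>F' \<inter> F. indicator I x *\<^sub>R mean f I) + (\<Sum>I\<in>F' - F. indicator I x *\<^sub>R mean f I)"
      unfolding mean_sum_def by (rule sum.Int_Diff[OF F'(1)])
    moreover have "(\<Sum>I\<in>?H. indicator I x *\<^sub>R v I)
      = (\<Sum>I\<in>F - F'. indicator I x *\<^sub>R v I) + (\<Sum>I\<in>F' - F. indicator I x *\<^sub>R v I)"
      using F F' by (intro sum.union_disjoint) auto
    moreover have "(\<Sum>I\<in>F - F'. indicator I x *\<^sub>R v I) = (\<Sum>I\<in>F - F'. indicator I x *\<^sub>R mean f I)"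
      by (intro sum.cong) (auto simp: v_def)
    moreover have "(\<Sum>I\<in>F' - F. indicator I x *\<^sub>R v I) = - (\<Sum>I\<in>F' - F. indicator I x *\<^sub>R mean f I)"
      unfolding sum_negf[symmetric] by (intro sum.cong) (auto simp: v_def)
    ultimately show ?thesis by (simp add: Int_commute)
  qed
  then have "E UNIV (\<lambda>x. mean_sum F x - mean_sum F' x) \<le> ennreal (16 * A) * (\<Sum>J\<in>?H. E J (\<lambda>_. v J))"
    using E_embedding[OF H, of v] by simp
  also have "(\<Sum>J\<in>?H. E J (\<lambda>_. v J)) = (\<Sum>J\<in>?H. ennreal (mean_energy J))"
  proof (intro sum.cong refl)
    fix J assume "J \<in> ?H"
    then have "J \<in> G" using H by blast
    moreover have "E J (\<lambda>_. v J) = E J (\<lambda>_. mean f J)"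
      by (simp add: v_def energy_on_def linear_neg[OF R.lin])
    ultimately show "E J (\<lambda>_. v J) = ennreal (mean_energy J)" by (simp add: mean_energy_eq)
  qed
  also have "\<dots> = ennreal (sum mean_energy ?H)" using mean_energy_nonneg by simp
  also have "sum mean_energy ?H = sum mean_energy (F - F') + sum mean_energy (F' - F)"
    using F F' by (intro sum.union_disjoint) auto
  finally show ?thesis
    using A_ge_1 by (simp add: ennreal_mult' sum_nonneg mean_energy_nonneg)
qed

lemma sum_mean_energy_le:
  assumes F: "finite F" "F \<subseteq> G"
  shows "ennreal (sum mean_energy F) \<le> ennreal (16 * A\<^sup>2) * E UNIV f"
proof -
  have "ennreal (sum mean_energy F) = (\<Sum>I\<in>F. ennreal (mean_energy I))"
    by (rule sum_ennreal[symmetric]) (rule mean_energy_nonneg)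
  also have "\<dots> = (\<Sum>I\<in>F. E I (\<lambda>_. mean f I))"
    using F by (intro sum.cong refl) (auto simp: mean_energy_eq)
  finally show ?thesis using sum_mean_energy[OF f f_fin F] by simp
qed

lemma energy_mean_sum:
  assumes F: "finite F" "F \<subseteq> G"
  shows "E UNIV (mean_sum F) \<le> ennreal (256 * A ^ 3) * E UNIV f"
proof -
  have "E UNIV (mean_sum F) \<le> ennreal (16 * A) * ennreal (sum mean_energy F)"
    using energy_mean_sum_diff[OF F, of "{}"] A_ge_1 by (simp add: mean_sum_def[of "{}"] ennreal_mult' sum_nonneg mean_energy_nonneg)
  also have "\<dots> \<le> ennreal (16 * A) * (ennreal (16 * A\<^sup>2) * E UNIV f)"
    by (intro mult_left_mono sum_mean_energy_le F) auto
  also have "\<dots> = ennreal (256 * A ^ 3) * E UNIV f"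
    using A_ge_1 by (simp add: mult.assoc[symmetric] ennreal_mult[symmetric] power2_eq_square power3_eq_cube)
  finally show ?thesis .
qed

lemma mean_energy_tail:
  assumes "0 < e"
  obtains F0 where "finite F0" "F0 \<subseteq> G" "\<And>F. finite F \<Longrightarrow> F \<subseteq> G - F0 \<Longrightarrow> sum mean_energy F \<le> e"
proof -
  define a where "a = enn2real (ennreal (16 * A\<^sup>2) * E UNIV f)"
  have bd: "sum mean_energy F \<le> a" if "finite F" "F \<subseteq> G" for F
  proof -
    have "ennreal (16 * A\<^sup>2) * E UNIV f < top" using f_fin by (simp add: ennreal_mult_less_top)
    then show ?thesis unfolding a_def
      using enn2real_mono[OF sum_mean_energy_le[OF that]] by (simp add: sum_nonneg mean_energy_nonneg)
  qed
  then have "mean_energy summable_on G"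
    by (intro nonneg_bdd_above_summable_on mean_energy_nonneg) (auto simp: bdd_above_def)
  then have lim: "(sum mean_energy \<longlongrightarrow> infsum mean_energy G) (finite_subsets_at_top G)" by (rule infsum_tendsto)
  have "eventually (\<lambda>F. infsum mean_energy G - e < sum mean_energy F) (finite_subsets_at_top G)"
    using lim assms by (intro order_tendstoD(1)) auto
  then obtain F0 where F0: "finite F0" "F0 \<subseteq> G" "\<And>F. finite F \<Longrightarrow> F0 \<subseteq> F \<Longrightarrow> F \<subseteq> G \<Longrightarrow> infsum mean_energy G - e < sum mean_energy F"
    unfolding eventually_finite_subsets_at_top by metis
  show ?thesis
  proof (rule that[OF F0(1,2)])
    fix F assume F: "finite F" "F \<subseteq> G - F0"
    have "sum mean_energy F0 + sum mean_energy F = sum mean_energy (F0 \<union> F)"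
      using F F0 by (intro sum.union_disjoint[symmetric]) auto
    also have "\<dots> \<le> infsum mean_energy G"
      using \<open>mean_energy summable_on G\<close> F F0 mean_energy_nonneg by (intro finite_sum_le_infsum) auto
    finally show "sum mean_energy F \<le> e" using F0(3)[OF F0(1) order_refl F0(2)] by linarith
  qed
qed

text \<open>Choose finite sets \<open>H k\<close> outside of which the mean energies add up to at most \<open>4^{-k}\<close>. The differences
  \<open>d k\<close> of consecutive partial sums have energy of order \<open>4^{-k}\<close>, so \<open>\<Sum>k. 2^k \<bar>R x (d k x)\<bar>^2\<close> is finite
  almost everywhere; the differences then decay geometrically and the partial sums over \<open>H k\<close> converge
  at such points. Fatou's lemma transfers the Cauchy estimate to the limit, for all finite index sets
  containing \<open>H k\<close>.\<close>

lemma sparse_limit_exists: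
  obtains g where "g \<in> borel_measurable lebesgue" "E UNIV g < \<infinity>"
    "((\<lambda>F. E UNIV (\<lambda>x. g x - mean_sum F x)) \<longlongrightarrow> 0) (finite_subsets_at_top G)"
proof -
  have "\<forall>k. \<exists>F0. finite F0 \<and> F0 \<subseteq> G \<and> (\<forall>F. finite F \<longrightarrow> F \<subseteq> G - F0 \<longrightarrow> sum mean_energy F \<le> (1/4) ^ k)"
  proof
    fix k :: nat
    have "(0::real) < (1/4) ^ k" by simp
    then show "\<exists>F0. finite F0 \<and> F0 \<subseteq> G \<and> (\<forall>F. finite F \<longrightarrow> F \<subseteq> G - F0 \<longrightarrow> sum mean_energy F \<le> (1/4) ^ k)"
      by (rule mean_energy_tail) blast
  qed
  then obtain H where H: "\<And>k. finite (H k)" "\<And>k. H k \<subseteq> G"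
    and tail: "\<And>k F. finite F \<Longrightarrow> F \<subseteq> G - H k \<Longrightarrow> sum mean_energy F \<le> (1/4) ^ k"
    by metis
  have diff: "E UNIV (\<lambda>x. mean_sum (H m) x - mean_sum F x) \<le> ennreal (32 * A * (1/4) ^ k)"
    if F: "finite F" "F \<subseteq> G" "H m - F \<subseteq> G - H k" and mk: "k \<le> m" for F m k
  proof -
    have "sum mean_energy (H m - F) \<le> (1/4) ^ k" using F H by (intro tail) auto
    moreover have "sum mean_energy (F - H m) \<le> (1/4) ^ m" using F H by (intro tail) auto
    moreover have "(1/4 :: real) ^ m \<le> (1/4) ^ k" using mk by (intro power_decreasing) auto
    ultimately have "sum mean_energy (H m - F) + sum mean_energy (F - H m) \<le> 2 * (1/4) ^ k" by linarith
    then have "16 * A * (sum mean_energy (H m - F) + sum mean_energy (F - H m)) \<le> 16 * A * (2 * (1/4) ^ k)"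
      by (rule mult_left_mono) (use A_ge_1 in simp)
    then show ?thesis
      by (intro order_trans[OF energy_mean_sum_diff[OF H F(1,2)]] ennreal_leI) simp
  qed
  define d where "d k x = mean_sum (H (Suc k)) x - mean_sum (H k) x" for k x
  have dm [measurable]: "d k \<in> borel_measurable lebesgue" for k
    unfolding d_def[abs_def] using H by (intro borel_measurable_diff mean_sum_meas)
  have dE: "E UNIV (d k) \<le> ennreal (32 * A * (1/4) ^ k)" for k
    unfolding d_def using H by (intro diff) auto
  have conv: "AE x in lebesgue. convergent (\<lambda>n. mean_sum (H n) x)"
  proof -
    have Rd: "(\<lambda>x. (norm (R x (d k x)))\<^sup>2) \<in> borel_measurable lebesgue" for k by (rule R.meas[OF dm])
    have "(\<integral>\<^sup>+x. (\<Sum>k. ennreal (2 ^ k) * ennreal ((norm (R x (d k x)))\<^sup>2)) \<partial>lebesgue)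
       = (\<Sum>k. ennreal (2 ^ k) * E UNIV (d k))"
      using Rd by (subst nn_integral_suminf) (auto simp: nn_integral_cmult energy_on_def)
    also have "\<dots> \<le> (\<Sum>k. ennreal (32 * A * (1/2) ^ k))"
    proof (intro suminf_le)
      fix k
      have "ennreal (2 ^ k) * E UNIV (d k) \<le> ennreal (2 ^ k) * ennreal (32 * A * (1/4) ^ k)"
        by (intro mult_left_mono dE) auto
      also have "\<dots> = ennreal (2 ^ k * (32 * A * (1/4) ^ k))"
        using A_ge_1 by (subst ennreal_mult) auto
      also have "2 ^ k * (32 * A * (1/4) ^ k) = 32 * A * (2 * (1/4)) ^ k"
        by (simp only: power_mult_distrib mult_ac)
      finally show "ennreal (2 ^ k) * E UNIV (d k) \<le> ennreal (32 * A * (1/2) ^ k)" by simp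
    qed auto
    also have "\<dots> = ennreal (\<Sum>k. 32 * A * (1/2) ^ k)"
      using A_ge_1 by (intro suminf_ennreal_eq summable_sums summable_mult summable_geometric) auto
    also have "\<dots> < \<infinity>" by simp
    finally have "AE x in lebesgue. (\<Sum>k. ennreal (2 ^ k) * ennreal ((norm (R x (d k x)))\<^sup>2)) \<noteq> \<infinity>"
      using Rd by (intro nn_integral_noteq_infinite) auto
    then show ?thesis
    proof (elim eventually_mono)
      fix x
      assume fin: "(\<Sum>k. ennreal (2 ^ k) * ennreal ((norm (R x (d k x)))\<^sup>2)) \<noteq> \<infinity>"
      then obtain M where M: "(\<Sum>k. ennreal (2 ^ k) * ennreal ((norm (R x (d k x)))\<^sup>2)) = ennreal M" "0 \<le> M"
        by (cases "\<Sum>k. ennreal (2 ^ k) * ennreal ((norm (R x (d k x)))\<^sup>2)") auto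
      define L where "L = onorm (Ri x)"
      have bl: "bounded_linear (Ri x)" using Ri.lin by (simp add: linear_linear)
      have bd: "norm (d k x) \<le> L * sqrt M * sqrt (1/2) ^ k" for k
      proof -
        have "ennreal (2 ^ k) * ennreal ((norm (R x (d k x)))\<^sup>2)
            \<le> (\<Sum>k. ennreal (2 ^ k) * ennreal ((norm (R x (d k x)))\<^sup>2))"
          using sum_le_suminf[of "\<lambda>k. ennreal (2 ^ k) * ennreal ((norm (R x (d k x)))\<^sup>2)" "{k}"] by simp
        then have "2 ^ k * (norm (R x (d k x)))\<^sup>2 \<le> M"
          using M(2) by (simp only: M(1)) (simp flip: ennreal_mult add: ennreal_le_iff del: ennreal_power)
        then have "(norm (R x (d k x)))\<^sup>2 \<le> M * (1/2) ^ k"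
          by (simp add: power_divide field_simps)
        then have "norm (R x (d k x)) \<le> sqrt (M * (1/2) ^ k)" by (rule real_le_rsqrt)
        then have 1: "norm (R x (d k x)) \<le> sqrt M * sqrt (1/2) ^ k"
          by (simp only: real_sqrt_mult real_sqrt_power)
        have "norm (d k x) = norm (Ri x (R x (d k x)))" by (simp add: Ri_R)
        also have "\<dots> \<le> L * norm (R x (d k x))" unfolding L_def by (rule onorm[OF bl])
        also have "\<dots> \<le> L * (sqrt M * sqrt (1/2) ^ k)"
          using 1 onorm_pos_le[OF bl] by (intro mult_left_mono) (auto simp: L_def)
        finally show ?thesis by (simp add: mult.assoc)
      qed
      have "summable (\<lambda>k. L * sqrt M * sqrt (1/2) ^ k)"
        by (intro summable_mult summable_geometric) (simp add: real_sqrt_divide)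
      then have "summable (\<lambda>k. d k x)"
        by (rule summable_comparison_test[rotated]) (use bd in auto)
      then have "convergent (\<lambda>n. \<Sum>k<n. d k x)" by (simp add: summable_iff_convergent)
      then have "convergent (\<lambda>n. mean_sum (H n) x - mean_sum (H 0) x)"
        by (simp add: d_def sum_lessThan_telescope[of "\<lambda>n. mean_sum (H n) x"])
      then show "convergent (\<lambda>n. mean_sum (H n) x)" by (simp add: convergent_diff_const_right_iff)
    qed
  qed
  define g where "g x = lim (\<lambda>n. mean_sum (H n) x)" for x
  have gm: "g \<in> borel_measurable lebesgue"
    unfolding g_def[abs_def] using H by (intro borel_measurable_lim_metric mean_sum_meas)
  have fatou: "E UNIV (\<lambda>x. g x - h x) \<le> liminf (\<lambda>n. E UNIV (\<lambda>x. mean_sum (H n) x - h x))"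
    if h: "h \<in> borel_measurable lebesgue" for h
  proof -
    have "E UNIV (\<lambda>x. g x - h x) \<le> (\<integral>\<^sup>+x. liminf (\<lambda>n. ennreal ((norm (R x (mean_sum (H n) x - h x)))\<^sup>2)) \<partial>lebesgue)"
      unfolding energy_on_def
    proof (rule nn_integral_mono_AE, use conv in \<open>rule eventually_mono\<close>)
      fix x assume "convergent (\<lambda>n. mean_sum (H n) x)"
      then have "(\<lambda>n. mean_sum (H n) x) \<longlonglongrightarrow> g x" by (simp add: g_def convergent_LIMSEQ_iff)
      moreover have "bounded_linear (R x)" using R.lin by (simp add: linear_linear)
      ultimately have "(\<lambda>n. ennreal ((norm (R x (mean_sum (H n) x - h x)))\<^sup>2)) \<longlonglongrightarrow> ennreal ((norm (R x (g x - h x)))\<^sup>2)"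
        by (intro tendsto_ennrealI tendsto_power tendsto_norm bounded_linear.tendsto[of "R x"] tendsto_diff tendsto_const)
      then have "liminf (\<lambda>n. ennreal ((norm (R x (mean_sum (H n) x - h x)))\<^sup>2)) = ennreal ((norm (R x (g x - h x)))\<^sup>2)"
        by (intro lim_imp_Liminf) auto
      then show "ennreal ((norm (R x (g x - h x)))\<^sup>2) * indicator UNIV x
          \<le> liminf (\<lambda>n. ennreal ((norm (R x (mean_sum (H n) x - h x)))\<^sup>2))" by simp
    qed
    also have "\<dots> \<le> liminf (\<lambda>n. \<integral>\<^sup>+x. ennreal ((norm (R x (mean_sum (H n) x - h x)))\<^sup>2) \<partial>lebesgue)"
      using H h by (intro nn_integral_liminf measurable_compose[OF R.meas measurable_ennreal] borel_measurable_diff mean_sum_meas)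
    finally show ?thesis by (simp add: energy_on_def)
  qed
  have lim: "E UNIV (\<lambda>x. g x - mean_sum F x) \<le> ennreal (32 * A * (1/4) ^ k)"
    if F: "finite F" "F \<subseteq> G" "H k \<subseteq> F" for F k
  proof -
    have "E UNIV (\<lambda>x. mean_sum (H n) x - mean_sum F x) \<le> ennreal (32 * A * (1/4) ^ k)" if "k \<le> n" for n
      using H(2)[of n] F(3) by (intro diff[OF F(1,2) _ that]) blast
    then have "eventually (\<lambda>n. E UNIV (\<lambda>x. mean_sum (H n) x - mean_sum F x) \<le> ennreal (32 * A * (1/4) ^ k)) sequentially"
      by (rule eventually_sequentiallyI)
    then have "liminf (\<lambda>n. E UNIV (\<lambda>x. mean_sum (H n) x - mean_sum F x)) \<le> ennreal (32 * A * (1/4) ^ k)"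
      by (intro order_trans[OF Liminf_mono Liminf_const[THEN eq_refl]]) auto
    with fatou[OF mean_sum_meas[OF F(2)]] show ?thesis by (rule order_trans)
  qed
  have tend: "((\<lambda>F. E UNIV (\<lambda>x. g x - mean_sum F x)) \<longlongrightarrow> 0) (finite_subsets_at_top G)"
  proof (rule order_tendstoI)
    fix a :: ennreal assume a: "0 < a"
    have "(\<lambda>k. ennreal (32 * A * (1/4) ^ k)) \<longlonglongrightarrow> ennreal (32 * A * 0)"
      by (intro tendsto_ennrealI tendsto_mult tendsto_const LIMSEQ_power_zero) auto
    then have "eventually (\<lambda>k. ennreal (32 * A * (1/4) ^ k) < a) sequentially"
      using a by (intro order_tendstoD(2)) auto
    then obtain k where k: "ennreal (32 * A * (1/4) ^ k) < a" by (auto simp: eventually_sequentially)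
    show "eventually (\<lambda>F. E UNIV (\<lambda>x. g x - mean_sum F x) < a) (finite_subsets_at_top G)"
      unfolding eventually_finite_subsets_at_top
      using H lim le_less_trans[OF _ k] by (intro exI[of _ "H k"]) auto
  qed simp
  have "E UNIV g = E UNIV (\<lambda>x. (g x - mean_sum (H 0) x) + mean_sum (H 0) x)" by simp
  also have "\<dots> \<le> ennreal (1 + 1) * E UNIV (\<lambda>x. g x - mean_sum (H 0) x) + ennreal (1 + 1 / 1) * E UNIV (mean_sum (H 0))"
    using H gm by (intro R.en_add_le borel_measurable_diff mean_sum_meas) auto
  also have "\<dots> < \<infinity>"
    using le_less_trans[OF lim[OF H order_refl, of 0]] le_less_trans[OF energy_mean_sum[OF H, of 0]] f_fin
    by (simp add: ennreal_mult_less_top)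
  finally show ?thesis using gm tend that by blast
qed

lemma sparse_limit_bound:
  assumes g: "g \<in> borel_measurable lebesgue"
    and lim: "((\<lambda>F. E UNIV (\<lambda>x. g x - mean_sum F x)) \<longlongrightarrow> 0) (finite_subsets_at_top G)"
  shows "E UNIV g \<le> ennreal (512 * A ^ 3) * E UNIV f"
proof -
  have "E UNIV g \<le> 2 * E UNIV (\<lambda>x. g x - mean_sum F x) + ennreal (512 * A ^ 3) * E UNIV f"
    if F: "finite F" "F \<subseteq> G" for F
  proof -
    have "E UNIV g = E UNIV (\<lambda>x. (g x - mean_sum F x) + mean_sum F x)" by simp
    also have "\<dots> \<le> ennreal (1 + 1) * E UNIV (\<lambda>x. g x - mean_sum F x) + ennreal (1 + 1 / 1) * E UNIV (mean_sum F)"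
      using F g by (intro R.en_add_le borel_measurable_diff mean_sum_meas) auto
    also have "\<dots> \<le> ennreal (1 + 1) * E UNIV (\<lambda>x. g x - mean_sum F x) + ennreal (1 + 1 / 1) * (ennreal (256 * A ^ 3) * E UNIV f)"
      by (intro add_left_mono mult_left_mono energy_mean_sum F) auto
    also have "ennreal (1 + 1 / 1) * (ennreal (256 * A ^ 3) * E UNIV f) = ennreal (512 * A ^ 3) * E UNIV f"
      using A_ge_1 by (simp add: mult.assoc[symmetric] ennreal_mult[symmetric] flip: ennreal_numeral)
    finally show ?thesis by simp
  qed
  then have "eventually (\<lambda>F. E UNIV g \<le> 2 * E UNIV (\<lambda>x. g x - mean_sum F x) + ennreal (512 * A ^ 3) * E UNIV f) (finite_subsets_at_top G)"
    by (intro eventually_finite_subsets_at_top_weakI)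
  moreover have "((\<lambda>F. 2 * E UNIV (\<lambda>x. g x - mean_sum F x) + ennreal (512 * A ^ 3) * E UNIV f)
      \<longlongrightarrow> 2 * 0 + ennreal (512 * A ^ 3) * E UNIV f) (finite_subsets_at_top G)"
    by (intro tendsto_add ennreal_tendsto_cmult lim tendsto_const) auto
  ultimately show ?thesis
    using tendsto_lowerbound[of _ _ "finite_subsets_at_top G"] by fastforce
qed

end
end

section \<open>Matrix weights and the sparse operator\<close>

lemma ennreal_mult_divide_cancel:
  fixes m z :: ennreal
  assumes "m \<noteq> 0" "m \<noteq> \<infinity>"
  shows "m * (z / m) = z"
proof -
  have "m * (z / m) = (z * m) / m" by (simp only: ennreal_times_divide mult.commute)
  also have "\<dots> = z" using assms by (intro mult_divide_eq_ennreal) auto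
  finally show ?thesis .
qed

text \<open>For a measurable \<open>g\<close> equality holds by linearity. The inner integral of the $A_2$ kernel is not
  known to be measurable, so the inequality is obtained from the simple functions below \<open>g\<close>.\<close>

lemma nn_integral_le_mult_divide:
  fixes g :: "'a \<Rightarrow> ennreal"
  assumes "m \<noteq> 0" "m \<noteq> \<infinity>"
  shows "(\<integral>\<^sup>+x. g x \<partial>M) \<le> m * (\<integral>\<^sup>+x. g x / m \<partial>M)"
proof -
  have "integral\<^sup>S M s \<le> m * (\<integral>\<^sup>+x. g x / m \<partial>M)" if s: "simple_function M s" "s \<le> g" for s
  proof -
    have [measurable]: "s \<in> borel_measurable M" using s(1) by (rule borel_measurable_simple_function)
    have "integral\<^sup>S M s = (\<integral>\<^sup>+x. s x \<partial>M)" using s(1) by (rule nn_integral_eq_simple_integral[symmetric])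
    also have "\<dots> = (\<integral>\<^sup>+x. m * (s x / m) \<partial>M)"
      by (simp only: ennreal_mult_divide_cancel[OF assms])
    also have "\<dots> = m * (\<integral>\<^sup>+x. s x / m \<partial>M)" by (rule nn_integral_cmult) simp
    also have "\<dots> \<le> m * (\<integral>\<^sup>+x. g x / m \<partial>M)"
      using s(2) by (intro mult_left_mono nn_integral_mono divide_right_mono_ennreal) (auto simp: le_fun_def)
    finally show ?thesis .
  qed
  then show ?thesis unfolding nn_integral_def by (intro SUP_least) auto
qed

lemma pos_definite_invertible:
  fixes A :: "complex^'n^'n"
  assumes "pos_definite A"
  shows "invertible A"
proof -
  have "x = 0" if "A *v x = 0" for x
    using assms that by (force simp: pos_definite_def Re_quad_form)
  then show ?thesis
    unfolding invertible_left_inverse using matrix_left_invertible_ker[of A] by blast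
qed

lemma pos_definite_mat_1: "pos_definite (mat 1 :: complex^'n^'n)"
  unfolding pos_definite_def Re_quad_form
  by (intro conjI hermitianI) (auto simp: matrix_vector_mul_lid)

lemma matrix_inv_vector:
  fixes A :: "complex^'n^'n"
  assumes "invertible A"
  shows "A *v (matrix_inv A *v u) = u" "matrix_inv A *v (A *v u) = u"
proof -
  have "A ** matrix_inv A = mat 1 \<and> matrix_inv A ** A = mat 1"
    unfolding matrix_inv_def by (rule someI_ex) (use assms in \<open>simp add: invertible_def\<close>)
  then show "A *v (matrix_inv A *v u) = u" "matrix_inv A *v (A *v u) = u"
    by (simp_all add: matrix_vector_mul_assoc matrix_vector_mul_lid)
qed

lemma borel_measurable_vec_component:
  fixes f :: "'a \<Rightarrow> 'b::real_normed_vector^'n"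
  shows "f \<in> borel_measurable M \<Longrightarrow> (\<lambda>x. f x $ i) \<in> borel_measurable M"
  by (rule borel_measurable_continuous_on[OF _ , where f = "\<lambda>v. v $ i"]) (auto intro!: continuous_intros)

lemma borel_measurable_matrix_form:
  fixes W :: "'a \<Rightarrow> complex^'n^'n"
  assumes W: "W \<in> borel_measurable M" and h: "h \<in> borel_measurable M"
  shows "(\<lambda>x. h x \<bullet> (W x *v h x)) \<in> borel_measurable M"
proof -
  note [measurable] = borel_measurable_vec_component[OF h] borel_measurable_vec_component[OF borel_measurable_vec_component[OF W]]
  show ?thesis unfolding inner_vec_def matrix_vector_mult_def by simp
qed

text \<open>Cramer's rule writes the inverse as a quotient of determinants, which are polynomials in the entries.\<close>

lemma borel_measurable_inverse_matrix_form:
  fixes W :: "'a \<Rightarrow> complex^'n^'n"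
  assumes W: "W \<in> borel_measurable M" and h: "h \<in> borel_measurable M"
    and inv: "\<And>x. invertible (W x)"
  shows "(\<lambda>x. h x \<bullet> (matrix_inv (W x) *v h x)) \<in> borel_measurable M"
proof -
  note [measurable] = borel_measurable_vec_component[OF h] borel_measurable_vec_component[OF borel_measurable_vec_component[OF W]]
  have det: "(\<lambda>x. det (\<chi> i j. F x i j)) \<in> borel_measurable M"
    if [measurable]: "\<And>i j. (\<lambda>x. F x i j) \<in> borel_measurable M" for F :: "'a \<Rightarrow> 'n \<Rightarrow> 'n \<Rightarrow> complex"
    unfolding det_def by simp
  have "matrix_inv (W x) *v h x = (\<chi> k. det (\<chi> i j. if j = k then h x $ i else W x $ i $ j) / det (\<chi> i j. W x $ i $ j))" for x
    using cramer[of "W x" "matrix_inv (W x) *v h x" "h x"] inv[of x] matrix_inv_vector(1)[OF inv[of x]]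
    by (simp add: invertible_det_nz)
  then have "(\<lambda>x. h x \<bullet> (matrix_inv (W x) *v h x))
    = (\<lambda>x. \<Sum>k\<in>UNIV. h x $ k \<bullet> (det (\<chi> i j. if j = k then h x $ i else W x $ i $ j) / det (\<chi> i j. W x $ i $ j)))"
    by (simp add: inner_vec_def)
  also have "\<dots> \<in> borel_measurable M"
    by (intro borel_measurable_sum borel_measurable_inner borel_measurable_divide det) auto
  finally show ?thesis .
qed

text \<open>A weight is positive definite only almost everywhere. Replacing it by the identity on the
  exceptional null set changes neither the \<open>L2\<close> energies nor the $A_2$ constant, and makes the roots
  inverse to each other at every point.\<close>

definition reg_weight :: "(real^'d \<Rightarrow> complex^'n^'n) \<Rightarrow> real^'d \<Rightarrow> complex^'n^'n" where
  "reg_weight W x = (if pos_definite (W x) then W x else mat 1)"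

definition weight_root :: "(real^'d \<Rightarrow> complex^'n^'n) \<Rightarrow> real^'d \<Rightarrow> complex^'n \<Rightarrow> complex^'n" where
  "weight_root W x u = mat_sqrt (reg_weight W x) *v u"

definition weight_root_inv :: "(real^'d \<Rightarrow> complex^'n^'n) \<Rightarrow> real^'d \<Rightarrow> complex^'n \<Rightarrow> complex^'n" where
  "weight_root_inv W x u = mat_inv_sqrt (reg_weight W x) *v u"

lemma pos_definite_reg_weight: "pos_definite (reg_weight W x)"
  by (simp add: reg_weight_def pos_definite_mat_1)

lemma root_inverse:
  "weight_root W x (weight_root_inv W x u) = u" "weight_root_inv W x (weight_root W x u) = u"
  unfolding weight_root_def weight_root_inv_def mat_inv_sqrt_def
  by (rule matrix_inv_vector pos_definite_invertible mat_sqrt_pos_definite pos_definite_reg_weight)+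

lemma root_sym: "weight_root W x u \<bullet> w = u \<bullet> weight_root W x w"
  using mat_sqrt_pos_definite(1)[OF pos_definite_reg_weight[of W x]]
  by (simp add: weight_root_def hermitian_inner pos_definite_def)

lemma root_inv_sym: "weight_root_inv W x u \<bullet> w = u \<bullet> weight_root_inv W x w"
  by (metis root_inverse(1) root_sym)

lemma root_root: "weight_root W x (weight_root W x u) = reg_weight W x *v u"
  by (simp add: weight_root_def matrix_vector_mul_assoc mat_sqrt_pos_definite(2)[OF pos_definite_reg_weight])

lemma root_inv_root_inv: "weight_root_inv W x (weight_root_inv W x u) = matrix_inv (reg_weight W x) *v u"
  by (metis root_inverse(2) root_root matrix_inv_vector(1)[OF pos_definite_invertible[OF pos_definite_reg_weight]])

lemma norm_root: "(norm (weight_root W x u))\<^sup>2 = u \<bullet> (reg_weight W x *v u)"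
  by (simp add: power2_norm_eq_inner root_sym root_root)

lemma norm_root_inv: "(norm (weight_root_inv W x u))\<^sup>2 = u \<bullet> (matrix_inv (reg_weight W x) *v u)"
  by (simp add: power2_norm_eq_inner root_inv_sym root_inv_root_inv)

lemma reg_weight_measurable:
  assumes "matrix_weight W"
  shows "reg_weight W \<in> borel_measurable lebesgue"
proof -
  have "{x. pos_definite (W x)} \<in> sets lebesgue"
  proof -
    have "AE x in lborel. \<not> \<not> pos_definite (W x)"
      using assms by (simp add: matrix_weight_def AE_completion_iff)
    then have "Measurable.pred lebesgue (\<lambda>x. \<not> pos_definite (W x))"
      by (rule sets_completion_AE)
    then have "UNIV - {x. \<not> pos_definite (W x)} \<in> sets lebesgue"
      by (intro sets.Diff) (auto simp: pred_def)
    then show ?thesis by (simp add: set_diff_eq)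
  qed
  then show ?thesis
    unfolding reg_weight_def[abs_def] using assms
    by (intro measurable_If) (auto simp: matrix_weight_def)
qed

lemma AE_reg_weight: "matrix_weight W \<Longrightarrow> AE x in lebesgue. reg_weight W x = W x"
  unfolding matrix_weight_def by (auto simp: reg_weight_def elim: eventually_mono)

lemma L2_energy_eq:
  assumes "matrix_weight W"
  shows "L2_energy W f = energy_on lebesgue (weight_root W) UNIV f"
  unfolding L2_energy_def energy_on_def
  by (intro nn_integral_cong_AE eventually_mono[OF AE_reg_weight[OF assms]]) (simp add: weight_root_def)

lemma A2_weight_root:
  fixes W :: "real^'d \<Rightarrow> complex^'n^'n"
  assumes W: "matrix_A2_weight W"
  shows "A2_weight (weight_root W) (weight_root_inv W) (enn2real (A2_const W))"
proof -
  have mw: "matrix_weight W" and fin: "A2_const W < \<infinity>" using W by (auto simp: matrix_A2_weight_def)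
  note AE = AE_reg_weight[OF mw]
  show ?thesis
  proof (intro A2_weight.intro measurable_form.intro A2_weight_axioms.intro)
    show "linear (weight_root W x)" "linear (weight_root_inv W x)" for x
      unfolding weight_root_def[abs_def] weight_root_inv_def[abs_def]
      by (rule bounded_linear.linear[OF matrix_vector_mul_bounded_linear])+
    show "(\<lambda>x. (norm (weight_root W x (h x)))\<^sup>2) \<in> borel_measurable lebesgue"
      if "h \<in> borel_measurable lebesgue" for h
      unfolding norm_root by (rule borel_measurable_matrix_form[OF reg_weight_measurable[OF mw] that])
    show "(\<lambda>x. (norm (weight_root_inv W x (h x)))\<^sup>2) \<in> borel_measurable lebesgue"
      if "h \<in> borel_measurable lebesgue" for h
      unfolding norm_root_inv
      by (rule borel_measurable_inverse_matrix_form[OF reg_weight_measurable[OF mw] that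
            pos_definite_invertible[OF pos_definite_reg_weight]])
    show "weight_root W x u \<bullet> w = u \<bullet> weight_root W x w" for x u w by (rule root_sym)
    show "weight_root W x (weight_root_inv W x u) = u" for x u by (rule root_inverse)
    show "weight_root_inv W x (weight_root W x u) = u" for x u by (rule root_inverse)
    fix I :: "(real^'d) set" assume I: "I \<in> cubes"
    define m where "m = emeasure lebesgue I"
    have m: "m \<noteq> 0" "m \<noteq> \<infinity>" unfolding m_def using emeasure_cubes_nonzero[OF I] emeasure_cubes_finite[OF I] .
    define k where "k x t = ennreal ((onorm (\<lambda>u. weight_root W x (weight_root_inv W t u)))\<^sup>2)" for x t
    define k' where "k' x t = ennreal ((op_norm (mat_sqrt (W x) ** mat_inv_sqrt (W t)))\<^sup>2)" for x t
    have kk: "k x t = k' x t" if "reg_weight W x = W x" "reg_weight W t = W t" for x t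
      using that by (simp add: k_def k'_def op_norm_def weight_root_def weight_root_inv_def matrix_vector_mul_assoc)
    have "(\<integral>\<^sup>+x\<in>I. (\<integral>\<^sup>+t\<in>I. k x t \<partial>lebesgue) \<partial>lebesgue) = (\<integral>\<^sup>+x\<in>I. (\<integral>\<^sup>+t\<in>I. k' x t \<partial>lebesgue) \<partial>lebesgue)"
    proof (rule nn_integral_cong_AE, rule eventually_mono[OF AE])
      fix x assume x: "reg_weight W x = W x"
      have "(\<integral>\<^sup>+t\<in>I. k x t \<partial>lebesgue) = (\<integral>\<^sup>+t\<in>I. k' x t \<partial>lebesgue)"
        by (rule nn_integral_cong_AE, rule eventually_mono[OF AE]) (simp add: kk x)
      then show "(\<integral>\<^sup>+t\<in>I. k x t \<partial>lebesgue) * indicator I x = (\<integral>\<^sup>+t\<in>I. k' x t \<partial>lebesgue) * indicator I x"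
        by simp
    qed
    also have "\<dots> \<le> m * (\<integral>\<^sup>+x. ((\<integral>\<^sup>+t\<in>I. k' x t \<partial>lebesgue) * indicator I x) / m \<partial>lebesgue)"
      by (rule nn_integral_le_mult_divide[OF m])
    also have "\<dots> = m * (\<integral>\<^sup>+x\<in>I. (\<integral>\<^sup>+t\<in>I. k' x t \<partial>lebesgue) / m \<partial>lebesgue)"
      by (intro arg_cong[where f = "\<lambda>z. m * z"] nn_integral_cong) (auto split: split_indicator)
    also have "\<dots> = m\<^sup>2 * ((\<integral>\<^sup>+x\<in>I. (\<integral>\<^sup>+t\<in>I. k' x t \<partial>lebesgue) / m \<partial>lebesgue) / m)"
      by (simp only: power2_eq_square mult.assoc ennreal_mult_divide_cancel[OF m])
    also have "\<dots> \<le> m\<^sup>2 * A2_const W"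
      unfolding A2_const_def m_def k'_def by (intro mult_left_mono SUP_upper I) auto
    also have "\<dots> = ennreal (enn2real (A2_const W)) * m\<^sup>2"
      using fin by (simp add: mult.commute)
    finally show "(\<integral>\<^sup>+x\<in>I. (\<integral>\<^sup>+t\<in>I. ennreal ((onorm (\<lambda>u. weight_root W x (weight_root_inv W t u)))\<^sup>2) \<partial>lebesgue) \<partial>lebesgue)
        \<le> ennreal (enn2real (A2_const W)) * (emeasure lebesgue I)\<^sup>2"
      by (simp add: k_def m_def)
  qed
qed

text \<open>The bound is proved for every unconditional limit because \<open>sparse_operator\<close> picks an unspecified one.\<close>

theorem sparse_operator_bound:
  fixes W :: "real^'d \<Rightarrow> complex^'n^'n"
  assumes W: "matrix_A2_weight W" and D: "dyadic_grid D" "G \<subseteq> D" and sparse: "sparse_collection G"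
    and f: "f \<in> L2_space W"
  shows "\<exists>g. has_sparse_sum W G f g"
    and "has_sparse_sum W G f g \<Longrightarrow> L2_energy W g \<le> ennreal (512 * enn2real (A2_const W) ^ 3) * L2_energy W f"
    and "1 \<le> enn2real (A2_const W)"
proof -
  interpret sparse_A2_weight "weight_root W" "weight_root_inv W" "enn2real (A2_const W)" D G
    by (intro sparse_A2_weight.intro A2_weight_root[OF W] sparse_family.intro D sparse)
  show "1 \<le> enn2real (A2_const W)" by (rule A_ge_1)
  have mw: "matrix_weight W" using W by (simp add: matrix_A2_weight_def)
  note en = L2_energy_eq[OF mw]
  have fm: "f \<in> borel_measurable lebesgue" and fE: "E UNIV f < \<infinity>"
    using f by (auto simp: L2_space_def en)
  have int: "set_integrable lebesgue I f" if "I \<in> G" for I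
    by (rule set_integrable_f[OF fm fE member_cubes[OF that]])
  have inti: "set_integrable lebesgue I (\<lambda>x. f x $ i)" if "I \<in> G" for I i
    using integrable_bounded_linear[OF bounded_linear_vec_nth int[OF that, unfolded set_integrable_def], of i]
    by (simp add: set_integrable_def)
  have avg: "avg I f = mean f I" if "I \<in> G" for I
    using integral_bounded_linear[OF bounded_linear_vec_nth int[OF that, unfolded set_integrable_def]]
    by (simp add: avg_def mean_def vec_eq_iff set_lebesgue_integral_def divide_inverse)
  have ps: "sparse_partial_sum F f x = mean_sum f F x" if "F \<subseteq> G" for F x
    unfolding sparse_partial_sum_def mean_sum_def[OF fm fE] using that avg by (intro sum.cong) auto
  have lim: "((\<lambda>F. L2_energy W (\<lambda>x. g x - sparse_partial_sum F f x)) \<longlongrightarrow> 0) (finite_subsets_at_top G)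
    \<longleftrightarrow> ((\<lambda>F. E UNIV (\<lambda>x. g x - mean_sum f F x)) \<longlongrightarrow> 0) (finite_subsets_at_top G)" for g
    by (intro tendsto_cong eventually_finite_subsets_at_top_weakI) (simp add: en ps)
  have iff: "has_sparse_sum W G f g \<longleftrightarrow> g \<in> borel_measurable lebesgue \<and> E UNIV g < \<infinity>
      \<and> ((\<lambda>F. E UNIV (\<lambda>x. g x - mean_sum f F x)) \<longlongrightarrow> 0) (finite_subsets_at_top G)" for g
    unfolding has_sparse_sum_def lim using inti by (auto simp: L2_space_def en)
  show "\<exists>g. has_sparse_sum W G f g"
    unfolding iff by (rule sparse_limit_exists[OF fm fE]) blast
  show "L2_energy W g \<le> ennreal (512 * enn2real (A2_const W) ^ 3) * L2_energy W f" if "has_sparse_sum W G f g"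
    using that unfolding iff en by (intro sparse_limit_bound[OF fm fE]) auto
qed

theorem proposition4p7:
  "\<exists>c::real. c > 0 \<and>
     (\<forall>(W :: real^'d \<Rightarrow> complex^'n^'n) (D :: (real^'d) set set) (G :: (real^'d) set set).
        matrix_A2_weight W \<longrightarrow> dyadic_grid D \<longrightarrow> G \<subseteq> D \<longrightarrow> sparse_collection G \<longrightarrow>
          (\<forall>f\<in>L2_space W. \<exists>g. has_sparse_sum W G f g) \<and>
          L2_op_norm W (sparse_operator W G) \<le> ennreal (c * enn2real (A2_const W) powr (3/2)))"
proof (intro exI[of _ 32] conjI allI impI ballI)
  fix W :: "real^'d \<Rightarrow> complex^'n^'n" and D G :: "(real^'d) set set"
  assume W: "matrix_A2_weight W" and D: "dyadic_grid D" "G \<subseteq> D" and sparse: "sparse_collection G"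
  note bound = sparse_operator_bound[OF W D sparse]
  show "\<exists>g. has_sparse_sum W G f g" if "f \<in> L2_space W" for f by (rule bound(1)[OF that])
  define A where "A = enn2real (A2_const W)"
  show "L2_op_norm W (sparse_operator W G) \<le> ennreal (32 * enn2real (A2_const W) powr (3/2))"
    unfolding L2_op_norm_def A_def[symmetric]
  proof (rule SUP_least)
    fix f assume "f \<in> {f \<in> L2_space W. L2_norm W f \<le> 1}"
    then have f: "f \<in> L2_space W" "L2_norm W f \<le> 1" by auto
    let ?g = "sparse_operator W G f"
    have g: "has_sparse_sum W G f ?g"
      unfolding sparse_operator_def by (rule someI_ex[OF bound(1)[OF f(1)]])
    have A: "1 \<le> A" unfolding A_def by (rule bound(3)[OF f(1)])
    have "L2_energy W f \<le> 1"
      using f by (cases "L2_energy W f") (auto simp: L2_norm_def L2_space_def)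
    then have "L2_energy W ?g \<le> ennreal (512 * A ^ 3) * 1"
      unfolding A_def by (intro order_trans[OF bound(2)[OF f(1) g]] mult_left_mono) auto
    then have "enn2real (L2_energy W ?g) \<le> 512 * A ^ 3"
      using A by (intro enn2real_leI) auto
    also have "\<dots> \<le> (32 * A powr (3/2))\<^sup>2"
    proof -
      have "(A powr (3/2))\<^sup>2 = A ^ 3"
        using A powr_add[of A "3/2" "3/2"] by (simp add: power2_eq_square)
      then show ?thesis using A by (simp add: power_mult_distrib)
    qed
    finally have "L2_norm W ?g \<le> 32 * A powr (3/2)"
      unfolding L2_norm_def using A by (intro real_le_lsqrt) auto
    then show "ennreal (L2_norm W ?g) \<le> ennreal (32 * A powr (3/2))" by (rule ennreal_leI)
  qed
qed simp

end
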